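(* Let $\alpha\in\mathbb R\setminus\mathbb N$. There does not exist a fundamental symmetry on the polynomial Fock space $F$ (with respect to the Bessel–Fischer product $\langle\cdot,\cdot\rangle_{\mathcal B}$) such that $((\mathcal F,\langle\cdot,\cdot\rangle_{\mathcal B}),\rho_0)$ is unitarizable. As a consequence, $((\mathcal F,\langle\cdot,\cdot\rangle_{\mathcal B}),\rho_0,d\rho)$ is not a strong superunitary representation of $\mathbb D(2,1;\alpha)$.
   Context: Conventions: $\mathbb N=\{0,1,2,\dots\}$, $\imath$ is the imaginary unit, $(a)_k=a(a+1)\cdots(a+k-1)$; $|x|$ is the parity of a homogeneous element. The Lie superalgebra $\mathfrak g=D(2,1;\alpha)$ (over $\mathbb R$): let $V_1,V_2,V_3$ be copies of $\mathbb R^2$ with basis $u_+^i=(1,0)^t,u_-^i=(0,1)^t$ and skew form $\psi_i$ with $\psi_i(u_+^i,u_-^i)=1$. Put $\mathfrak g_{\bar 0}=\mathfrak{sl}(V_1)\oplus\mathfrak{sl}(V_2)\oplus\mathfrak{sl}(V_3)$, $\mathfrak g_{\bar 1}=V_1\otimes V_2\otimes V_3$ with the outer tensor product action, and odd-odd bracket $[x_1\otimes x_2\otimes x_3,y_1\otimes y_2\otimes y_3]=\sigma_1\psi_2(x_2,y_2)\psi_3(x_3,y_3)p_1(x_1,y_1)+\sigma_2\psi_3(x_3,y_3)\psi_1(x_1,y_1)p_2(x_2,y_2)+\sigma_3\psi_1(x_1,y_1)\psi_2(x_2,y_2)p_3(x_3,y_3)$, where $p_i(x,y)z=\psi_i(y,z)x-\psi_i(z,x)y$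 and $(\sigma_1,\sigma_2,\sigma_3)=(\frac{1+\alpha}2,-\frac12,-\frac\alpha2)$. Write $u_{\pm\pm\pm}=u^1_\pm\otimes u^2_\pm\otimes u^3_\pm$, $E_i=\begin{pmatrix}0&1\\0&0\end{pmatrix}$, $F_i=\begin{pmatrix}0&0\\1&0\end{pmatrix}$, $H_i=\begin{pmatrix}1&0\\0&-1\end{pmatrix}\in\mathfrak{sl}(V_i)$. The Lie supergroup $\mathbb D(2,1;\alpha)=(G_0,\mathfrak g)$ (pair of a Lie group and a Lie superalgebra with $\mathrm{Lie}(G_0)\cong\mathfrak g_{\bar0}$ and an extension $\mathrm{Ad}$ of the adjoint representation to $\mathfrak g$): $G_0=SL(V_1)\times SL(V_2)\times SL(V_3)$, with $\mathrm{Ad}(A_1,A_2,A_3)(x\otimes y\otimes z)=A_1x\otimes A_2y\otimes A_3z$ and $\mathrm{Ad}(A_1,A_2,A_3)X_i=A_iX_iA_i^{-1}$ for $X_i\in\mathfrak{sl}(V_i)$. Polynomial Fock space: $F:=\mathcal P(\mathbb C^{2|2})/\mathcal I$, where $\mathcal P(\mathbb C^{2|2})$ is the superalgebra of complex superpolynomials in even $z_1,z_2$ and odd $z_3,z_4$ and $\mathcal I$ is the ideal generated by $2z_1z_2+z_3z_4,z_2^2,z_2z_3,z_2z_4$. The classes of $z_1^k,z_1^kz_2,z_1^kz_3,z_1^kz_4$ ($k\in\mathbb N$) form a basis. Bessel operators ($\partial_i=\partial_{z_i}$): $\mathcal B(z_1)=(-\alpha+z_1\partial_1+z_3\partial_3+z_4\partial_4)\partial_1-2\alpha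 z_2\partial_3\partial_4$, $\mathcal B(z_2)=(-1+z_2\partial_2+z_3\partial_3+z_4\partial_4)\partial_2-2z_1\partial_3\partial_4$, $\mathcal B(z_3)=(-2\alpha+2z_1\partial_1+2\alpha z_2\partial_2+2(1+\alpha)z_3\partial_3)\partial_4+z_3\partial_1\partial_2$, $\mathcal B(z_4)=(2\alpha-2z_1\partial_1-2\alpha z_2\partial_2-2(1+\alpha)z_4\partial_4)\partial_3+z_4\partial_1\partial_2$. Bessel–Fischer product: $\langle p,q\rangle_{\mathcal B}:=p(\mathcal B)\bar q(z)|_{z=0}$, where $\bar q$ has conjugated coefficients and $p(\mathcal B)$ is obtained by replacing $z_i$ by $\mathcal B(z_i)$. It is a non-degenerate superhermitian sesquilinear form on $F$; on the basis its only non-zero values are $\langle z_1^k,z_1^k\rangle_{\mathcal B}=-\langle z_1^kz_2,z_1^kz_2\rangle_{\mathcal B}=k!(-\alpha)_k$ and $\langle z_1^kz_3,z_1^kz_4\rangle_{\mathcal B}=-\langle z_1^kz_4,z_1^kz_3\rangle_{\mathcal B}=2k!(-\alpha)_{k+1}$. The Fock space $\mathcal F$ is the completion of $F$ for the inner product $(\cdot,\cdot)_S$ for which the basis is orthogonal with $(z_1^k,z_1^k)_S=(z_1^kz_2,z_1^kz_2)_S=k!|(-\alpha)_k|$, $(z_1^kz_3,z_1^kz_3)_S=(z_1^kz_4,z_1^kz_4)_S=2k!|(-\alpha)_{k+1}|$; $\langle\cdot,\cdot\rangle_{\mathcal B}$ extends to it. The representation $d\rho$ of $\mathfrak g$ on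 $F$: $d\rho(F_2)=-\tfrac\imath2(z_1+\mathcal B(z_1))-\tfrac\imath2(-\alpha+2z_1\partial_1+z_3\partial_3+z_4\partial_4)$, $d\rho(E_2)=-\tfrac\imath2(z_1+\mathcal B(z_1))+\tfrac\imath2(-\alpha+2z_1\partial_1+z_3\partial_3+z_4\partial_4)$, $d\rho(F_3)=-\tfrac\imath2(z_2+\mathcal B(z_2))-\tfrac\imath2(-1+2z_2\partial_2+z_3\partial_3+z_4\partial_4)$, $d\rho(E_3)=-\tfrac\imath2(z_2+\mathcal B(z_2))+\tfrac\imath2(-1+2z_2\partial_2+z_3\partial_3+z_4\partial_4)$, $d\rho(F_1)=2z_3\partial_4$, $d\rho(E_1)=\tfrac12z_4\partial_3$, $d\rho(H_1)=z_4\partial_4-z_3\partial_3$, $d\rho(H_2)=z_1-\mathcal B(z_1)$, $d\rho(H_3)=z_2-\mathcal B(z_2)$, $d\rho(u_{---})=\tfrac\imath2(z_3+\mathcal B(z_3))+\tfrac\imath2(z_3\partial_1+2\alpha z_2\partial_4+z_3\partial_2+2z_1\partial_4)$, $d\rho(u_{-++})=-\tfrac\imath2(z_3+\mathcal B(z_3))+\tfrac\imath2(z_3\partial_1+2\alpha z_2\partial_4+z_3\partial_2+2z_1\partial_4)$, $d\rho(u_{+--})=\tfrac\imath4(z_4+\mathcal B(z_4))+\tfrac\imath4(z_4\partial_1-2\alpha z_2\partial_3+z_4\partial_2-2z_1\partial_3)$, $d\rho(u_{+++})=-\tfrac\imath4(z_4+\mathcal B(z_4))+\tfrac\imath4(z_4\partial_1-2\alpha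 z_2\partial_3+z_4\partial_2-2z_1\partial_3)$, $d\rho(u_{--+}+u_{-+-})=-(z_3-\mathcal B(z_3))$, $d\rho(u_{+-+}+u_{++-})=-\tfrac12(z_4-\mathcal B(z_4))$, $d\rho(u_{--+}-u_{-+-})=-z_3\partial_1-2\alpha z_2\partial_4+z_3\partial_2+2z_1\partial_4$, $d\rho(u_{+-+}-u_{++-})=\tfrac12(-z_4\partial_1+2\alpha z_2\partial_3+z_4\partial_2-2z_1\partial_3)$. The group action $\rho_0$ of $G_0$ on $\mathcal F$ is defined by $\rho_0(\exp(X)):=\exp(d\rho(X))$, $X\in\mathfrak g_{\bar0}$; its derived action is $d\rho|_{\mathfrak g_{\bar0}}$. Fundamental symmetry: an endomorphism $J$ of a Hermitian superspace with $J^4=1$, $\langle Jx,Jy\rangle=\langle x,y\rangle$ and $(x,y)_J:=\langle x,J(y)\rangle$ an inner product. $(\mathcal H,\pi_0)$ is unitarizable (with $J$) if $\pi_0$ is unitary with respect to $(\cdot,\cdot)_J$; in particular $(d\pi_0(X)p,q)_J=-(p,d\pi_0(X)q)_J$ for $X\in\mathfrak g_{\bar 0}$. Superunitary representation of $(G_0,\mathfrak g)$: a triple $(\mathcal H,\pi_0,d\pi)$ with $\mathcal H$ a Hilbert superspace (a Hermitian superspace that is a Hilbert space for $(\cdot,\cdot)_J$ for some fundamental symmetry $J$); $\pi_0$ a group morphism from $G_0$ to the superunitary operators (bounded even $\psi$ with $\psi^\dagger\psi=\psi\psi^\dagger=1$, where $\langle T^\dagger x,y\rangle=(-1)^{|T||x|}\langle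 x,Ty\rangle$); $g\mapsto\pi_0(g)v$ continuous for every $v$; and $d\pi:\mathfrak g\to\mathrm{End}(\mathcal H^\infty)$ an $\mathbb R$-Lie superalgebra morphism on smooth vectors with $d\pi=d\pi_0$ on $\mathfrak g_{\bar0}$, skew-supersymmetric, and $\pi_0(g)d\pi(X)\pi_0(g)^{-1}=d\pi(\mathrm{Ad}(g)X)$ for $g\in G_0,X\in\mathfrak g_{\bar1}$. A strong superunitary representation is a superunitary representation such that $(\mathcal H,\pi_0)$ is unitarizable for some fundamental symmetry and $(\mathcal H,\pi_0,d\pi)$ admits a restriction to $(D(G_0),D(\mathfrak g))$, where $D(\mathfrak g)=[\mathfrak g_{\bar1},\mathfrak g_{\bar1}]\oplus\mathfrak g_{\bar1}$ and $D(G_0)$ is the connected Lie subgroup of $G_0$ with Lie algebra $[\mathfrak g_{\bar1},\mathfrak g_{\bar1}]$. *)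

theory Defs
  imports "HOL-Analysis.Analysis" "HOL-Computational_Algebra.Polynomial"
begin

section \<open>Complex vector spaces\<close>

class complex_vector = real_vector +
  fixes scaleC :: "complex \<Rightarrow> 'a \<Rightarrow> 'a"  (infixr \<open>*\<^sub>C\<close> 75)
  assumes scaleC_add_right: "c *\<^sub>C (x + y) = c *\<^sub>C x + c *\<^sub>C y"
    and scaleC_add_left: "(c + d) *\<^sub>C x = c *\<^sub>C x + d *\<^sub>C x"
    and scaleC_scaleC: "c *\<^sub>C d *\<^sub>C x = (c * d) *\<^sub>C x"
    and scaleC_of_real: "complex_of_real r *\<^sub>C x = r *\<^sub>R x"

lemma scaleC_one [simp]: "1 *\<^sub>C (x::'a::complex_vector) = x"
  using scaleC_of_real[of 1 x] by simp

lemma scaleC_zero_left [simp]: "0 *\<^sub>C (x::'a::complex_vector) = 0"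
  using scaleC_of_real[of 0 x] by simp

lemma scaleC_zero_right [simp]: "c *\<^sub>C (0::'a::complex_vector) = 0"
  using scaleC_add_right[of c 0 "0::'a"] by simp

definition clinear :: "('a::complex_vector \<Rightarrow> 'b::complex_vector) \<Rightarrow> bool" where
  "clinear T \<longleftrightarrow> (\<forall>x y. T (x + y) = T x + T y) \<and> (\<forall>c x. T (c *\<^sub>C x) = c *\<^sub>C T x)"

definition csubspace :: "'a::complex_vector set \<Rightarrow> bool" where
  "csubspace S \<longleftrightarrow> 0 \<in> S \<and> (\<forall>x\<in>S. \<forall>y\<in>S. x + y \<in> S) \<and> (\<forall>c. \<forall>x\<in>S. c *\<^sub>C x \<in> S)"

text \<open>Sesquilinear forms are linear in the first and antilinear in the second argument.\<close>

definition sesquilinear :: "('a::complex_vector \<Rightarrow> 'a \<Rightarrow> complex) \<Rightarrow> bool" where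
  "sesquilinear B \<longleftrightarrow>
     (\<forall>x y z. B (x + y) z = B x z + B y z) \<and> (\<forall>c x z. B (c *\<^sub>C x) z = c * B x z) \<and>
     (\<forall>x y z. B x (y + z) = B x y + B x z) \<and> (\<forall>c x z. B x (c *\<^sub>C z) = cnj c * B x z)"

definition inner_product :: "('a::complex_vector \<Rightarrow> 'a \<Rightarrow> complex) \<Rightarrow> bool" where
  "inner_product ip \<longleftrightarrow> sesquilinear ip \<and> (\<forall>x y. ip x y = cnj (ip y x)) \<and>
     (\<forall>x. x \<noteq> 0 \<longrightarrow> Re (ip x x) > 0)"

definition fundamental_symmetry ::
  "('a::complex_vector \<Rightarrow> 'a \<Rightarrow> complex) \<Rightarrow> ('a \<Rightarrow> 'a) \<Rightarrow> bool" where
  "fundamental_symmetry B J \<longleftrightarrow> clinear J \<and> (\<forall>x. (J ^^ 4) x = x) \<and>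
     (\<forall>x y. B (J x) (J y) = B x y) \<and> inner_product (\<lambda>x y. B x (J y))"

definition unitary_wrt :: "('a::complex_vector \<Rightarrow> 'a \<Rightarrow> complex) \<Rightarrow> ('a \<Rightarrow> 'a) \<Rightarrow> bool" where
  "unitary_wrt ip T \<longleftrightarrow> clinear T \<and> bij T \<and> (\<forall>x y. ip (T x) (T y) = ip x y)"


section \<open>Superpolynomials in two even and two odd variables\<close>

text \<open>
  The value \<open>SP p0 p3 p4 p34\<close> stands for \<open>p0 + p3 z3 + p4 z4 + p34 z3 z4\<close>.  The
  coefficients are polynomials in \<open>z2\<close> (the outer variable) over polynomials in \<open>z1\<close>,
  so that \<open>coeff (coeff p b) a\<close> is the coefficient of \<open>z1^a z2^b\<close>.
\<close>

datatype spoly = SP (sp0: "complex poly poly") (sp3: "complex poly poly")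
  (sp4: "complex poly poly") (sp34: "complex poly poly")

instantiation spoly :: ring_1
begin
definition "0 = SP 0 0 0 0"
definition "1 = SP 1 0 0 0"
definition "p + q = SP (sp0 p + sp0 q) (sp3 p + sp3 q) (sp4 p + sp4 q) (sp34 p + sp34 q)"
definition "p - q = SP (sp0 p - sp0 q) (sp3 p - sp3 q) (sp4 p - sp4 q) (sp34 p - sp34 q)"
definition "- p = SP (- sp0 p) (- sp3 p) (- sp4 p) (- sp34 p)"
definition "p * q = SP (sp0 p * sp0 q) (sp0 p * sp3 q + sp3 p * sp0 q)
  (sp0 p * sp4 q + sp4 p * sp0 q)
  (sp0 p * sp34 q + sp34 p * sp0 q + sp3 p * sp4 q - sp4 p * sp3 q)"
lemmas spoly_ring_defs = zero_spoly_def one_spoly_def plus_spoly_def minus_spoly_def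
  uminus_spoly_def times_spoly_def
instance
  by standard (simp_all add: spoly_ring_defs algebra_simps)
end

instantiation spoly :: complex_vector
begin
definition "c *\<^sub>C p = SP (smult [:c:] (sp0 p)) (smult [:c:] (sp3 p)) (smult [:c:] (sp4 p))
  (smult [:c:] (sp34 p))"
definition "r *\<^sub>R p = complex_of_real r *\<^sub>C (p::spoly)"
lemmas spoly_scale_defs = scaleC_spoly_def scaleR_spoly_def
instance
  by standard
    (auto simp: spoly_scale_defs spoly_ring_defs smult_add_right mult.commute pCons_one
      simp flip: smult_add_left)
end

lemma spoly_sel [simp]:
  "sp0 0 = 0" "sp3 0 = 0" "sp4 0 = 0" "sp34 0 = 0"
  "sp0 (p + q) = sp0 p + sp0 q" "sp3 (p + q) = sp3 p + sp3 q"
  "sp4 (p + q) = sp4 p + sp4 q" "sp34 (p + q) = sp34 p + sp34 q"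
  "sp0 (p - q) = sp0 p - sp0 q" "sp3 (p - q) = sp3 p - sp3 q"
  "sp4 (p - q) = sp4 p - sp4 q" "sp34 (p - q) = sp34 p - sp34 q"
  "sp0 (- p) = - sp0 p" "sp3 (- p) = - sp3 p" "sp4 (- p) = - sp4 p" "sp34 (- p) = - sp34 p"
  "sp0 (c *\<^sub>C p) = smult [:c:] (sp0 p)" "sp3 (c *\<^sub>C p) = smult [:c:] (sp3 p)"
  "sp4 (c *\<^sub>C p) = smult [:c:] (sp4 p)" "sp34 (c *\<^sub>C p) = smult [:c:] (sp34 p)"
  "sp0 (r *\<^sub>R p) = smult [:of_real r:] (sp0 p)" "sp3 (r *\<^sub>R p) = smult [:of_real r:] (sp3 p)"
  "sp4 (r *\<^sub>R p) = smult [:of_real r:] (sp4 p)" "sp34 (r *\<^sub>R p) = smult [:of_real r:] (sp34 p)"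
  by (simp_all add: spoly_ring_defs spoly_scale_defs)

definition z1 :: spoly where "z1 = SP [:[:0, 1:]:] 0 0 0"
definition z2 :: spoly where "z2 = SP [:0, 1:] 0 0 0"
definition z3 :: spoly where "z3 = SP 0 1 0 0"
definition z4 :: spoly where "z4 = SP 0 0 1 0"

lemma z_mult_sel [simp]:
  "sp0 (z1 * p) = smult [:0, 1:] (sp0 p)" "sp3 (z1 * p) = smult [:0, 1:] (sp3 p)"
  "sp4 (z1 * p) = smult [:0, 1:] (sp4 p)" "sp34 (z1 * p) = smult [:0, 1:] (sp34 p)"
  "sp0 (z2 * p) = pCons 0 (sp0 p)" "sp3 (z2 * p) = pCons 0 (sp3 p)"
  "sp4 (z2 * p) = pCons 0 (sp4 p)" "sp34 (z2 * p) = pCons 0 (sp34 p)"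
  "sp0 (z3 * p) = 0" "sp3 (z3 * p) = sp0 p" "sp4 (z3 * p) = 0" "sp34 (z3 * p) = sp4 p"
  "sp0 (z4 * p) = 0" "sp3 (z4 * p) = 0" "sp4 (z4 * p) = sp0 p" "sp34 (z4 * p) = - sp3 p"
  by (simp_all add: z1_def z2_def z3_def z4_def times_spoly_def)

text \<open>Partial derivatives; \<open>d3\<close> and \<open>d4\<close> are odd left derivations, so
  \<open>d4 (z3 * z4) = - z3\<close>.\<close>

definition d1 :: "spoly \<Rightarrow> spoly" where
  "d1 p = SP (map_poly pderiv (sp0 p)) (map_poly pderiv (sp3 p))
     (map_poly pderiv (sp4 p)) (map_poly pderiv (sp34 p))"
definition d2 :: "spoly \<Rightarrow> spoly" where
  "d2 p = SP (pderiv (sp0 p)) (pderiv (sp3 p)) (pderiv (sp4 p)) (pderiv (sp34 p))"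
definition d3 :: "spoly \<Rightarrow> spoly" where "d3 p = SP (sp3 p) 0 (sp34 p) 0"
definition d4 :: "spoly \<Rightarrow> spoly" where "d4 p = SP (sp4 p) (- sp34 p) 0 0"

lemma coeff_map_pderiv [simp]: "coeff (map_poly pderiv p) n = pderiv (coeff p n)"
  by (simp add: coeff_map_poly)

lemma map_pderiv_linear [simp]:
  fixes p q :: "complex poly poly"
  shows "map_poly pderiv (p + q) = map_poly pderiv p + map_poly pderiv q"
    "map_poly pderiv (p - q) = map_poly pderiv p - map_poly pderiv q"
    "map_poly pderiv (- p) = - map_poly pderiv p"
    "map_poly pderiv (smult [:c:] p) = smult [:c:] (map_poly pderiv p)"
  by (intro poly_eqI; simp add: pderiv_add pderiv_diff pderiv_minus pderiv_smult)+

lemma d_sel [simp]: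
  "sp0 (d1 p) = map_poly pderiv (sp0 p)" "sp3 (d1 p) = map_poly pderiv (sp3 p)"
  "sp4 (d1 p) = map_poly pderiv (sp4 p)" "sp34 (d1 p) = map_poly pderiv (sp34 p)"
  "sp0 (d2 p) = pderiv (sp0 p)" "sp3 (d2 p) = pderiv (sp3 p)"
  "sp4 (d2 p) = pderiv (sp4 p)" "sp34 (d2 p) = pderiv (sp34 p)"
  "sp0 (d3 p) = sp3 p" "sp3 (d3 p) = 0" "sp4 (d3 p) = sp34 p" "sp34 (d3 p) = 0"
  "sp0 (d4 p) = sp4 p" "sp3 (d4 p) = - sp34 p" "sp4 (d4 p) = 0" "sp34 (d4 p) = 0"
  by (simp_all add: d1_def d2_def d3_def d4_def)

definition sp_cnj :: "spoly \<Rightarrow> spoly" where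
  "sp_cnj p = SP (map_poly (map_poly cnj) (sp0 p)) (map_poly (map_poly cnj) (sp3 p))
     (map_poly (map_poly cnj) (sp4 p)) (map_poly (map_poly cnj) (sp34 p))"

definition sp_const :: "spoly \<Rightarrow> complex" where
  "sp_const p = coeff (coeff (sp0 p) 0) 0"


section \<open>The Bessel operators\<close>

definition B1 :: "real \<Rightarrow> spoly \<Rightarrow> spoly" where
  "B1 \<alpha> p = (- \<alpha>) *\<^sub>R d1 p + z1 * d1 (d1 p) + z3 * d3 (d1 p) + z4 * d4 (d1 p)
     - (2 * \<alpha>) *\<^sub>R (z2 * d3 (d4 p))"
definition B2 :: "spoly \<Rightarrow> spoly" where
  "B2 p = - d2 p + z2 * d2 (d2 p) + z3 * d3 (d2 p) + z4 * d4 (d2 p)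
     - 2 *\<^sub>R (z1 * d3 (d4 p))"
definition B3 :: "real \<Rightarrow> spoly \<Rightarrow> spoly" where
  "B3 \<alpha> p = (- 2 * \<alpha>) *\<^sub>R d4 p + 2 *\<^sub>R (z1 * d1 (d4 p)) + (2 * \<alpha>) *\<^sub>R (z2 * d2 (d4 p))
     + (2 * (1 + \<alpha>)) *\<^sub>R (z3 * d3 (d4 p)) + z3 * d1 (d2 p)"
definition B4 :: "real \<Rightarrow> spoly \<Rightarrow> spoly" where
  "B4 \<alpha> p = (2 * \<alpha>) *\<^sub>R d3 p - 2 *\<^sub>R (z1 * d1 (d3 p)) - (2 * \<alpha>) *\<^sub>R (z2 * d2 (d3 p))
     - (2 * (1 + \<alpha>)) *\<^sub>R (z4 * d4 (d3 p)) + z4 * d1 (d2 p)"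

lemmas B_defs = B1_def B2_def B3_def B4_def

lemma spoly_eqI:
  "sp0 p = sp0 q \<Longrightarrow> sp3 p = sp3 q \<Longrightarrow> sp4 p = sp4 q \<Longrightarrow> sp34 p = sp34 q \<Longrightarrow> p = q"
  by (simp add: spoly.expand)

lemma d_add:
  "d1 (p + q) = d1 p + d1 q" "d2 (p + q) = d2 p + d2 q"
  "d3 (p + q) = d3 p + d3 q" "d4 (p + q) = d4 p + d4 q"
  by (auto intro!: spoly_eqI simp: pderiv_add)

lemma d_diff:
  "d1 (p - q) = d1 p - d1 q" "d2 (p - q) = d2 p - d2 q"
  "d3 (p - q) = d3 p - d3 q" "d4 (p - q) = d4 p - d4 q"
  by (auto intro!: spoly_eqI simp: pderiv_diff)

lemma d_scaleC:
  "d1 (c *\<^sub>C p) = c *\<^sub>C d1 p" "d2 (c *\<^sub>C p) = c *\<^sub>C d2 p"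
  "d3 (c *\<^sub>C p) = c *\<^sub>C d3 p" "d4 (c *\<^sub>C p) = c *\<^sub>C d4 p"
  by (auto intro!: spoly_eqI simp: pderiv_smult)

lemma scaleC_diff_right: "c *\<^sub>C (x - y) = c *\<^sub>C x - c *\<^sub>C (y::'a::complex_vector)"
  using scaleC_add_right[of c "x - y" y] by simp

lemma scaleC_uminus_right: "c *\<^sub>C (- x) = - (c *\<^sub>C (x::'a::complex_vector))"
  using scaleC_diff_right[of c 0 x] by simp

lemma scaleC_diff_left: "(c - d) *\<^sub>C x = c *\<^sub>C x - d *\<^sub>C (x::'a::complex_vector)"
  using scaleC_add_left[of "c - d" d x] by simp

lemma mult_scaleC_spoly: "p * (c *\<^sub>C q) = c *\<^sub>C (p * (q::spoly))"
  by (rule spoly_eqI) (simp_all add: times_spoly_def smult_add_right smult_diff_right)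

lemma scaleC_scaleR: "c *\<^sub>C (r *\<^sub>R x) = r *\<^sub>R (c *\<^sub>C (x::'a::complex_vector))"
  by (simp flip: scaleC_of_real add: scaleC_scaleC mult.commute)

lemma B_add:
  "B1 \<alpha> (p + q) = B1 \<alpha> p + B1 \<alpha> q" "B2 (p + q) = B2 p + B2 q"
  "B3 \<alpha> (p + q) = B3 \<alpha> p + B3 \<alpha> q" "B4 \<alpha> (p + q) = B4 \<alpha> p + B4 \<alpha> q"
  by (simp_all add: B_defs d_add algebra_simps)

lemma B_diff:
  "B1 \<alpha> (p - q) = B1 \<alpha> p - B1 \<alpha> q" "B2 (p - q) = B2 p - B2 q"
  "B3 \<alpha> (p - q) = B3 \<alpha> p - B3 \<alpha> q" "B4 \<alpha> (p - q) = B4 \<alpha> p - B4 \<alpha> q"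
  by (simp_all add: B_defs d_diff algebra_simps)


section \<open>The ideal and the polynomial Fock space\<close>

inductive_set fock_ideal :: "spoly set" where
  gen1: "2 * z1 * z2 + z3 * z4 \<in> fock_ideal"
| gen2: "z2 * z2 \<in> fock_ideal"
| gen3: "z2 * z3 \<in> fock_ideal"
| gen4: "z2 * z4 \<in> fock_ideal"
| add: "p \<in> fock_ideal \<Longrightarrow> q \<in> fock_ideal \<Longrightarrow> p + q \<in> fock_ideal"
| mult_left: "p \<in> fock_ideal \<Longrightarrow> a * p \<in> fock_ideal"
| mult_right: "p \<in> fock_ideal \<Longrightarrow> p * a \<in> fock_ideal"

lemma two_sp: "(2::spoly) = SP [:[:2:]:] 0 0 0"
proof -
  have "(2::spoly) = 1 + 1" by simp
  also have "\<dots> = SP (1 + 1) 0 0 0" by (simp add: spoly_ring_defs)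
  also have "(1 + 1 :: complex poly poly) = [:[:2:]:]" by (simp add: one_pCons)
  finally show ?thesis .
qed

lemma fock_ideal_iff:
  "p \<in> fock_ideal \<longleftrightarrow> coeff (sp0 p) 0 = 0 \<and>
     coeff (sp0 p) 1 = [:0, 2:] * coeff (sp34 p) 0 \<and>
     coeff (sp3 p) 0 = 0 \<and> coeff (sp4 p) 0 = 0"  (is "_ \<longleftrightarrow> ?N p")
proof
  have c1: "coeff (a * b) (Suc 0) = coeff a 0 * coeff b 1 + coeff a 1 * coeff b 0"
    for a b :: "complex poly poly"
    by (simp add: coeff_mult)
  show "?N p" if "p \<in> fock_ideal"
    using that
  proof induction
    case (add p q)
    then show ?case by (simp add: algebra_simps)
  next
    case (mult_left p a)
    then show ?case by (simp add: times_spoly_def coeff_mult_0 c1)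
  next
    case (mult_right p a)
    then show ?case by (simp add: times_spoly_def coeff_mult_0 c1 algebra_simps)
  qed (simp_all add: z1_def z2_def z3_def z4_def two_sp times_spoly_def plus_spoly_def
        coeff_mult_0 c1)
  assume N: "?N p"
  obtain c s where c: "sp34 p = pCons c s" by (cases "sp34 p") auto
  obtain t where t: "sp3 p = pCons 0 t" using N by (cases "sp3 p") auto
  obtain u where u: "sp4 p = pCons 0 u" using N by (cases "sp4 p") auto
  obtain r where r: "sp0 p = pCons 0 (pCons ([:0, 2:] * c) r)"
  proof -
    obtain a q where "sp0 p = pCons a q" by (cases "sp0 p") auto
    moreover obtain b r where "q = pCons b r" by (cases q) auto
    ultimately show ?thesis using N c that by auto
  qed
  have "p = SP [:c:] 0 0 0 * (2 * z1 * z2 + z3 * z4) + SP r 0 0 0 * (z2 * z2)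
     + SP t 0 0 0 * (z2 * z3) + SP u 0 0 0 * (z2 * z4) + (SP s 0 0 0 * (z2 * z3)) * z4"
    by (rule spoly_eqI)
      (simp_all add: r t u c z1_def z2_def z3_def z4_def two_sp times_spoly_def plus_spoly_def)
  also have "\<dots> \<in> fock_ideal"
    by (intro fock_ideal.intros)
  finally show "p \<in> fock_ideal" .
qed

lemma fock_ideal_zero [simp]: "0 \<in> fock_ideal"
  by (simp add: fock_ideal_iff)

lemma fock_ideal_diff: "p \<in> fock_ideal \<Longrightarrow> q \<in> fock_ideal \<Longrightarrow> p - q \<in> fock_ideal"
  by (simp add: fock_ideal_iff algebra_simps)

lemma fock_ideal_uminus: "p \<in> fock_ideal \<Longrightarrow> - p \<in> fock_ideal"
  by (simp add: fock_ideal_iff)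

lemma fock_ideal_scaleC: "p \<in> fock_ideal \<Longrightarrow> c *\<^sub>C p \<in> fock_ideal"
proof -
  have "c *\<^sub>C p = SP [:[:c:]:] 0 0 0 * p"
    by (rule spoly_eqI) (simp_all add: times_spoly_def)
  then show "p \<in> fock_ideal \<Longrightarrow> c *\<^sub>C p \<in> fock_ideal"
    by (simp add: fock_ideal.mult_left)
qed

lemma fock_ideal_scaleR: "p \<in> fock_ideal \<Longrightarrow> r *\<^sub>R p \<in> fock_ideal"
  using fock_ideal_scaleC[of p "of_real r"] by (simp add: scaleC_of_real)

lemmas fock_ideal_closed = fock_ideal.add fock_ideal_diff fock_ideal_uminus
  fock_ideal_scaleC fock_ideal_scaleR fock_ideal.mult_left

lemma coeff_two_mult: "coeff (2 * q) n = 2 * coeff (q :: complex poly poly) n"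
  using coeff_add[of q q n] unfolding mult_2 .

lemma two_mult_smult: "2 * q = smult 2 (q :: complex poly)"
  by (simp add: numeral_poly)

lemma B1_ideal: "p \<in> fock_ideal \<Longrightarrow> B1 \<alpha> p \<in> fock_ideal"
  apply (simp add: fock_ideal_iff B_defs coeff_pCons pderiv_smult pderiv_pCons pderiv_diff
      pderiv_add pderiv_minus coeff_pderiv coeff_two_mult two_mult_smult
      smult_add_right smult_diff_right)
  apply ((intro conjI impI poly_eqI)?;
      simp add: coeff_pCons coeff_pderiv algebra_simps split: nat.split)
  done

lemma B2_ideal: "p \<in> fock_ideal \<Longrightarrow> B2 p \<in> fock_ideal"
  by (simp add: fock_ideal_iff B_defs coeff_pCons pderiv_smult pderiv_pCons pderiv_diff
      pderiv_add pderiv_minus coeff_pderiv coeff_two_mult two_mult_smult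
      smult_add_right smult_diff_right)

lemma B3_ideal: "p \<in> fock_ideal \<Longrightarrow> B3 \<alpha> p \<in> fock_ideal"
  apply (simp add: fock_ideal_iff B_defs coeff_pCons pderiv_smult pderiv_pCons pderiv_diff
      pderiv_add pderiv_minus coeff_pderiv coeff_two_mult two_mult_smult
      smult_add_right smult_diff_right)
  apply ((intro conjI impI poly_eqI)?;
      simp add: coeff_pCons coeff_pderiv algebra_simps split: nat.split)
  done

lemma B4_ideal: "p \<in> fock_ideal \<Longrightarrow> B4 \<alpha> p \<in> fock_ideal"
  apply (simp add: fock_ideal_iff B_defs coeff_pCons pderiv_smult pderiv_pCons pderiv_diff
      pderiv_add pderiv_minus coeff_pderiv coeff_two_mult two_mult_smult
      smult_add_right smult_diff_right)
  apply ((intro conjI impI poly_eqI)?;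
      simp add: coeff_pCons coeff_pderiv algebra_simps split: nat.split)
  done

lemma B22_ideal: "B2 (B2 p) \<in> fock_ideal"
  by (simp add: fock_ideal_iff B_defs coeff_pCons pderiv_smult pderiv_pCons pderiv_diff
      pderiv_add pderiv_minus coeff_pderiv coeff_two_mult two_mult_smult
      smult_add_right smult_diff_right)

lemma B23_ideal: "B2 (B3 \<alpha> p) \<in> fock_ideal"
  by (simp add: fock_ideal_iff B_defs coeff_pCons pderiv_smult pderiv_pCons pderiv_diff
      pderiv_add pderiv_minus coeff_pderiv coeff_two_mult two_mult_smult
      smult_add_right smult_diff_right)

lemma B24_ideal: "B2 (B4 \<alpha> p) \<in> fock_ideal"
  by (simp add: fock_ideal_iff B_defs coeff_pCons pderiv_smult pderiv_pCons pderiv_diff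
      pderiv_add pderiv_minus coeff_pderiv coeff_two_mult two_mult_smult
      smult_add_right smult_diff_right)

lemma B1234_ideal: "2 *\<^sub>R B1 \<alpha> (B2 p) + B3 \<alpha> (B4 \<alpha> p) \<in> fock_ideal"
  apply (simp add: fock_ideal_iff B_defs coeff_pCons pderiv_smult pderiv_pCons pderiv_diff
      pderiv_add pderiv_minus coeff_pderiv coeff_two_mult two_mult_smult
      smult_add_right smult_diff_right)
  apply ((intro conjI impI poly_eqI)?;
      simp add: coeff_pCons coeff_pderiv algebra_simps split: nat.split)
  done

lemmas B_ideal = B1_ideal B2_ideal B3_ideal B4_ideal

lemma B_scaleC:
  "B1 \<alpha> (c *\<^sub>C p) = c *\<^sub>C B1 \<alpha> p" "B2 (c *\<^sub>C p) = c *\<^sub>C B2 p"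
  "B3 \<alpha> (c *\<^sub>C p) = c *\<^sub>C B3 \<alpha> p" "B4 \<alpha> (c *\<^sub>C p) = c *\<^sub>C B4 \<alpha> p"
  by (simp_all add: B_defs d_scaleC mult_scaleC_spoly scaleC_add_right scaleC_diff_right
      scaleC_scaleR scaleC_uminus_right)

definition fock_eq :: "spoly \<Rightarrow> spoly \<Rightarrow> bool" where
  "fock_eq p q \<longleftrightarrow> p - q \<in> fock_ideal"

lemma equivp_fock_eq: "equivp fock_eq"
proof (rule equivpI)
  show "reflp fock_eq" by (simp add: reflp_def fock_eq_def)
  show "symp fock_eq"
    unfolding symp_def fock_eq_def using fock_ideal_uminus by (metis minus_diff_eq)
  show "transp fock_eq"
    unfolding transp_def fock_eq_def using fock_ideal.add by (metis diff_add_cancel add_diff_eq)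
qed

quotient_type fock_poly = spoly / fock_eq
  by (rule equivp_fock_eq)

instantiation fock_poly :: complex_vector
begin
lift_definition zero_fock_poly :: fock_poly is 0 .
lift_definition plus_fock_poly :: "fock_poly \<Rightarrow> fock_poly \<Rightarrow> fock_poly" is "(+)"
  unfolding fock_eq_def by (metis fock_ideal.add add_diff_add)
lift_definition minus_fock_poly :: "fock_poly \<Rightarrow> fock_poly \<Rightarrow> fock_poly" is "(-)"
proof -
  fix p p' q q' assume "fock_eq p p'" "fock_eq q q'"
  then have "(p - p') - (q - q') \<in> fock_ideal"
    unfolding fock_eq_def by (rule fock_ideal_diff)
  then show "fock_eq (p - q) (p' - q')" by (simp add: fock_eq_def algebra_simps)
qed
lift_definition uminus_fock_poly :: "fock_poly \<Rightarrow> fock_poly" is uminus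
  unfolding fock_eq_def by (metis fock_ideal_uminus minus_diff_minus)
lift_definition scaleC_fock_poly :: "complex \<Rightarrow> fock_poly \<Rightarrow> fock_poly" is scaleC
  unfolding fock_eq_def by (metis fock_ideal_scaleC scaleC_diff_right)
lift_definition scaleR_fock_poly :: "real \<Rightarrow> fock_poly \<Rightarrow> fock_poly" is scaleR
  unfolding fock_eq_def by (metis fock_ideal_scaleR scaleR_diff_right)
instance
  by standard (transfer; simp add: fock_eq_def algebra_simps scaleC_add_right scaleC_add_left
      scaleC_scaleC scaleC_of_real)+
end

section \<open>The Bessel--Fischer product\<close>

text \<open>\<open>eval1 A r v\<close> is \<open>r(A) v\<close> for a polynomial \<open>r\<close> in one variable, \<open>eval2 A B p v\<close> is
  \<open>p(A, B) v\<close> for \<open>p\<close> in the even variables \<open>z1, z2\<close>.\<close>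

definition eval1 :: "(spoly \<Rightarrow> spoly) \<Rightarrow> complex poly \<Rightarrow> spoly \<Rightarrow> spoly" where
  "eval1 A r v = (\<Sum>a\<le>degree r. coeff r a *\<^sub>C (A ^^ a) v)"
definition eval2 ::
  "(spoly \<Rightarrow> spoly) \<Rightarrow> (spoly \<Rightarrow> spoly) \<Rightarrow> complex poly poly \<Rightarrow> spoly \<Rightarrow> spoly" where
  "eval2 A B p v = (\<Sum>b\<le>degree p. eval1 A (coeff p b) ((B ^^ b) v))"

definition bessel_subst :: "real \<Rightarrow> spoly \<Rightarrow> spoly \<Rightarrow> spoly" where
  "bessel_subst \<alpha> p q =
     eval2 (B1 \<alpha>) B2 (sp0 p) q + eval2 (B1 \<alpha>) B2 (sp3 p) (B3 \<alpha> q)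
     + eval2 (B1 \<alpha>) B2 (sp4 p) (B4 \<alpha> q) + eval2 (B1 \<alpha>) B2 (sp34 p) (B3 \<alpha> (B4 \<alpha> q))"

lemma eval1_bound:
  assumes "degree r \<le> N"
  shows "eval1 A r v = (\<Sum>a\<le>N. coeff r a *\<^sub>C (A ^^ a) v)"
  unfolding eval1_def
  by (rule sum.mono_neutral_left) (use assms in \<open>auto simp: coeff_eq_0\<close>)

lemma eval1_zero [simp]: "eval1 A 0 v = 0"
  by (simp add: eval1_def)

lemma eval1_diff: "eval1 A (r - s) v = eval1 A r v - eval1 A s v"
proof -
  define N where "N = max (degree r) (degree s)"
  have *: "degree r \<le> N" "degree s \<le> N" "degree (r - s) \<le> N"
    by (auto simp: N_def degree_diff_le_max)
  show ?thesis
    unfolding eval1_bound[OF *(1)] eval1_bound[OF *(2)] eval1_bound[OF *(3)]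
    by (simp add: scaleC_diff_left sum_subtractf)
qed

lemma eval2_bound:
  assumes "degree p \<le> N"
  shows "eval2 A B p v = (\<Sum>b\<le>N. eval1 A (coeff p b) ((B ^^ b) v))"
  unfolding eval2_def
  by (rule sum.mono_neutral_left) (use assms in \<open>auto simp: coeff_eq_0\<close>)

lemma eval2_diff: "eval2 A B (p - q) v = eval2 A B p v - eval2 A B q v"
proof -
  define N where "N = max (degree p) (degree q)"
  have *: "degree p \<le> N" "degree q \<le> N" "degree (p - q) \<le> N"
    by (auto simp: N_def degree_diff_le_max)
  show ?thesis
    unfolding eval2_bound[OF *(1)] eval2_bound[OF *(2)] eval2_bound[OF *(3)]
    by (simp add: eval1_diff sum_subtractf)
qed

lemma bessel_subst_diff_left:
  "bessel_subst \<alpha> (p - p') q = bessel_subst \<alpha> p q - bessel_subst \<alpha> p' q"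
  by (simp add: bessel_subst_def eval2_diff)

lemma funpow_diff:
  fixes A :: "spoly \<Rightarrow> spoly"
  assumes "\<And>x y. A (x - y) = A x - A y"
  shows "(A ^^ n) (x - y) = (A ^^ n) x - (A ^^ n) y"
  by (induction n) (simp_all add: assms)

lemma eval2_diff_right:
  assumes "\<And>x y. A (x - y) = A x - A y" "\<And>x y. B (x - y) = B x - B y"
  shows "eval2 A B p (x - y) = eval2 A B p x - eval2 A B p y"
  by (simp add: eval2_def eval1_def funpow_diff[of A, OF assms(1)] funpow_diff[of B, OF assms(2)]
      scaleC_diff_right sum_subtractf)

lemma bessel_subst_diff_right:
  "bessel_subst \<alpha> p (q - q') = bessel_subst \<alpha> p q - bessel_subst \<alpha> p q'"
  by (simp add: bessel_subst_def B_diff eval2_diff_right)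

lemma fock_ideal_sum: "(\<And>i. i \<in> I \<Longrightarrow> f i \<in> fock_ideal) \<Longrightarrow> sum f I \<in> fock_ideal"
  by (induction I rule: infinite_finite_induct) (auto intro: fock_ideal.add)

lemma funpow_ideal:
  assumes "\<And>x. x \<in> fock_ideal \<Longrightarrow> A x \<in> fock_ideal" "v \<in> fock_ideal"
  shows "(A ^^ n) v \<in> fock_ideal"
  by (induction n) (simp_all add: assms)

lemma eval1_ideal: "v \<in> fock_ideal \<Longrightarrow> eval1 (B1 \<alpha>) r v \<in> fock_ideal"
  unfolding eval1_def by (intro fock_ideal_sum fock_ideal_scaleC funpow_ideal B_ideal)

lemma eval2_ideal: "v \<in> fock_ideal \<Longrightarrow> eval2 (B1 \<alpha>) B2 p v \<in> fock_ideal"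
  unfolding eval2_def by (intro fock_ideal_sum eval1_ideal funpow_ideal B_ideal)

lemma bessel_subst_ideal_right: "q \<in> fock_ideal \<Longrightarrow> bessel_subst \<alpha> p q \<in> fock_ideal"
  unfolding bessel_subst_def by (intro fock_ideal.add eval2_ideal B_ideal)

text \<open>Modulo the ideal only the first terms in \<open>z2\<close> matter.\<close>

lemma eval2_split:
  "eval2 A B p v = eval1 A (coeff p 0) v + eval1 A (coeff p 1) (B v) +
     (\<Sum>b\<in>{2..degree p}. eval1 A (coeff p b) ((B ^^ b) v))"
proof -
  define N where "N = max 1 (degree p)"
  have "{..N} = {0, 1} \<union> {2..N}" by (auto simp: N_def)
  moreover have "(\<Sum>b\<in>{2..N}. eval1 A (coeff p b) ((B ^^ b) v)) =
    (\<Sum>b\<in>{2..degree p}. eval1 A (coeff p b) ((B ^^ b) v))"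
    by (rule sum.mono_neutral_right) (auto simp: N_def coeff_eq_0)
  ultimately show ?thesis
    by (subst eval2_bound[of p N]) (auto simp: N_def sum.union_disjoint add.assoc)
qed

lemma eval2_high:
  assumes "B2 (B2 v) \<in> fock_ideal"
  shows "(\<Sum>b\<in>{2..n}. eval1 (B1 \<alpha>) (coeff p b) ((B2 ^^ b) v)) \<in> fock_ideal"
proof (intro fock_ideal_sum eval1_ideal)
  fix b :: nat assume "b \<in> {2..n}"
  then obtain m where "b = Suc (Suc m)"
    by (auto dest!: le_Suc_ex)
  then have "(B2 ^^ b) v = (B2 ^^ m) (B2 (B2 v))"
    by (simp only: funpow_Suc_right o_apply)
  then show "(B2 ^^ b) v \<in> fock_ideal"
    using assms by (simp add: funpow_ideal B2_ideal)
qed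

lemma B1_pow:
  "(B1 \<alpha> ^^ n) (c *\<^sub>C x) = c *\<^sub>C (B1 \<alpha> ^^ n) x"
  "(B1 \<alpha> ^^ n) (x + y) = (B1 \<alpha> ^^ n) x + (B1 \<alpha> ^^ n) y"
  by (induction n) (simp_all add: B_scaleC B_add)

lemma eval1_add_right:
  "eval1 (B1 \<alpha>) r (x + y) = eval1 (B1 \<alpha>) r x + eval1 (B1 \<alpha>) r y"
  by (simp add: eval1_def B1_pow scaleC_add_right sum.distrib)

lemma eval1_times_x: "eval1 (B1 \<alpha>) ([:0, 2:] * r) x = eval1 (B1 \<alpha>) r (2 *\<^sub>R B1 \<alpha> x)"
proof -
  have "eval1 (B1 \<alpha>) ([:0, 2:] * r) x =
      (\<Sum>a\<le>Suc (degree r). coeff ([:0, 2:] * r) a *\<^sub>C (B1 \<alpha> ^^ a) x)"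
    by (rule eval1_bound) (use degree_mult_le[of "[:0,2:]" r] in simp)
  also have "\<dots> = (\<Sum>a\<le>degree r. (2 * coeff r a) *\<^sub>C (B1 \<alpha> ^^ a) (B1 \<alpha> x))"
    by (subst sum.atMost_Suc_shift) (simp add: funpow_swap1)
  also have "\<dots> = eval1 (B1 \<alpha>) r (2 *\<^sub>R B1 \<alpha> x)"
    by (simp add: eval1_def B1_pow scaleC_scaleC mult.commute flip: scaleC_of_real)
  finally show ?thesis .
qed

lemma bessel_subst_ideal_left:
  assumes "p \<in> fock_ideal"
  shows "bessel_subst \<alpha> p q \<in> fock_ideal"
proof -
  let ?e = "eval1 (B1 \<alpha>)"
  note p = assms[unfolded fock_ideal_iff]
  let ?h = "\<lambda>p v. \<Sum>b\<in>{2..degree p}. ?e (coeff p b) ((B2 ^^ b) v)"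
  have h: "?h p v \<in> fock_ideal" for p v
    by (rule eval2_high) (rule B22_ideal)
  have "bessel_subst \<alpha> p q =
     ?e (coeff (sp34 p) 0) (2 *\<^sub>R B1 \<alpha> (B2 q) + B3 \<alpha> (B4 \<alpha> q))
     + ?e (coeff (sp3 p) 1) (B2 (B3 \<alpha> q)) + ?e (coeff (sp4 p) 1) (B2 (B4 \<alpha> q))
     + ?e (coeff (sp34 p) 1) (B2 (B3 \<alpha> (B4 \<alpha> q)))
     + (?h (sp0 p) q + ?h (sp3 p) (B3 \<alpha> q) + ?h (sp4 p) (B4 \<alpha> q) + ?h (sp34 p) (B3 \<alpha> (B4 \<alpha> q)))"
    unfolding bessel_subst_def eval2_split[of _ _ "sp0 p"] eval2_split[of _ _ "sp3 p"]
      eval2_split[of _ _ "sp4 p"] eval2_split[of _ _ "sp34 p"] eval1_add_right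
    using p by (simp only: eval1_times_x eval1_zero) (simp add: algebra_simps)
  also have "\<dots> \<in> fock_ideal"
    by (intro fock_ideal.add h eval1_ideal B1234_ideal B23_ideal B24_ideal)
  finally show ?thesis .
qed

lemma sp_const_ideal: "p \<in> fock_ideal \<Longrightarrow> sp_const p = 0"
  by (simp add: fock_ideal_iff sp_const_def)

lemma sp_const_diff: "sp_const (p - q) = sp_const p - sp_const q"
  by (simp add: sp_const_def)

lemma map_cnj_simps:
  "map_poly cnj (x - y) = map_poly cnj x - map_poly cnj y"
  "map_poly cnj (x * z) = map_poly cnj x * map_poly cnj z"
  by (intro poly_eqI; simp add: coeff_map_poly coeff_mult)+

lemma sp_cnj_diff: "sp_cnj (p - q) = sp_cnj p - sp_cnj q"
  by (rule spoly_eqI) (auto simp: sp_cnj_def coeff_map_poly map_cnj_simps intro!: poly_eqI)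

lemma sp_cnj_ideal: "p \<in> fock_ideal \<Longrightarrow> sp_cnj p \<in> fock_ideal"
  by (simp add: fock_ideal_iff sp_cnj_def coeff_map_poly map_poly_pCons map_poly_smult)

lift_definition bessel_fischer :: "real \<Rightarrow> fock_poly \<Rightarrow> fock_poly \<Rightarrow> complex" is
  "\<lambda>\<alpha> p q. sp_const (bessel_subst \<alpha> p (sp_cnj q))"
proof -
  fix \<alpha> p p' q q' assume *: "fock_eq p p'" "fock_eq q q'"
  have "sp_const (bessel_subst \<alpha> p (sp_cnj q)) - sp_const (bessel_subst \<alpha> p' (sp_cnj q)) = 0"
    using bessel_subst_ideal_left[OF *(1)[unfolded fock_eq_def]]
    by (simp add: sp_const_ideal bessel_subst_diff_left flip: sp_const_diff)
  moreover have
    "sp_const (bessel_subst \<alpha> p' (sp_cnj q)) - sp_const (bessel_subst \<alpha> p' (sp_cnj q')) = 0"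
    using bessel_subst_ideal_right[OF sp_cnj_ideal[OF *(2)[unfolded fock_eq_def]]]
    by (simp add: sp_const_ideal sp_cnj_diff bessel_subst_diff_right flip: sp_const_diff)
  ultimately show "sp_const (bessel_subst \<alpha> p (sp_cnj q)) = sp_const (bessel_subst \<alpha> p' (sp_cnj q'))"
    by simp
qed

section \<open>Square-summable families\<close>

typedef 'i ell2 = "{f :: 'i \<Rightarrow> complex. (\<lambda>i. (cmod (f i))\<^sup>2) summable_on UNIV}"
  morphisms ell2_nth Abs_ell2
  by (rule exI[of _ "\<lambda>_. 0"]) simp

setup_lifting type_definition_ell2

lemma ell2_summable: "(\<lambda>i. (cmod (ell2_nth x i))\<^sup>2) summable_on UNIV"
  using ell2_nth[of x] by simp

lemma ell2_add_aux:
  assumes "(\<lambda>i. (cmod (f i))\<^sup>2) summable_on UNIV" "(\<lambda>i. (cmod (g i))\<^sup>2) summable_on UNIV"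
  shows "(\<lambda>i. (cmod (f i + g i))\<^sup>2) summable_on UNIV"
proof (rule summable_on_comparison_test)
  show "(\<lambda>i. 2 * (cmod (f i))\<^sup>2 + 2 * (cmod (g i))\<^sup>2) summable_on UNIV"
    by (intro summable_on_add summable_on_cmult_right assms)
  show "(cmod (f i + g i))\<^sup>2 \<le> 2 * (cmod (f i))\<^sup>2 + 2 * (cmod (g i))\<^sup>2" for i
  proof -
    have "(cmod (f i + g i))\<^sup>2 \<le> (cmod (f i) + cmod (g i))\<^sup>2"
      by (intro power_mono norm_triangle_ineq) simp
    also have "\<dots> \<le> 2 * (cmod (f i))\<^sup>2 + 2 * (cmod (g i))\<^sup>2"
      using sum_squares_bound[of "cmod (f i)" "cmod (g i)"] unfolding power2_sum by linarith
    finally show ?thesis .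
  qed
qed simp

instantiation ell2 :: (type) complex_vector
begin
lift_definition zero_ell2 :: "'a ell2" is "\<lambda>_. 0" by simp
lift_definition plus_ell2 :: "'a ell2 \<Rightarrow> 'a ell2 \<Rightarrow> 'a ell2" is "\<lambda>f g i. f i + g i"
  by (rule ell2_add_aux)
lift_definition uminus_ell2 :: "'a ell2 \<Rightarrow> 'a ell2" is "\<lambda>f i. - f i" by simp
lift_definition minus_ell2 :: "'a ell2 \<Rightarrow> 'a ell2 \<Rightarrow> 'a ell2" is "\<lambda>f g i. f i - g i"
  using ell2_add_aux[of _ "\<lambda>i. - _ i"] by simp
lift_definition scaleC_ell2 :: "complex \<Rightarrow> 'a ell2 \<Rightarrow> 'a ell2" is "\<lambda>c f i. c * f i"
  by (simp add: norm_mult power_mult_distrib summable_on_cmult_right)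
lift_definition scaleR_ell2 :: "real \<Rightarrow> 'a ell2 \<Rightarrow> 'a ell2" is "\<lambda>c f i. complex_of_real c * f i"
  by (simp add: norm_mult power_mult_distrib summable_on_cmult_right)
instance
  by standard (simp_all add: zero_ell2.rep_eq plus_ell2.rep_eq minus_ell2.rep_eq
      uminus_ell2.rep_eq scaleC_ell2.rep_eq scaleR_ell2.rep_eq algebra_simps
      flip: ell2_nth_inject)
end

lemma ell2_nth_simps [simp]:
  "ell2_nth 0 i = 0" "ell2_nth (x + y) i = ell2_nth x i + ell2_nth y i"
  "ell2_nth (x - y) i = ell2_nth x i - ell2_nth y i" "ell2_nth (- x) i = - ell2_nth x i"
  "ell2_nth (c *\<^sub>C x) i = c * ell2_nth x i"
  "ell2_nth (r *\<^sub>R x) i = complex_of_real r * ell2_nth x i"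
  by (transfer; simp)+

lemma ell2_eqI: "(\<And>i. ell2_nth x i = ell2_nth y i) \<Longrightarrow> x = y"
  by (metis ell2_nth_inject ext)

lemma ell2_inner_summable: "(\<lambda>i. norm (Re (ell2_nth x i * cnj (ell2_nth y i)))) summable_on UNIV"
proof (rule summable_on_comparison_test)
  show "(\<lambda>i. (cmod (ell2_nth x i))\<^sup>2 + (cmod (ell2_nth y i))\<^sup>2) summable_on UNIV"
    by (intro summable_on_add ell2_summable)
  show "norm (Re (ell2_nth x i * cnj (ell2_nth y i)))
      \<le> (cmod (ell2_nth x i))\<^sup>2 + (cmod (ell2_nth y i))\<^sup>2" for i
  proof -
    have "norm (Re (ell2_nth x i * cnj (ell2_nth y i))) \<le> cmod (ell2_nth x i) * cmod (ell2_nth y i)"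
      using abs_Re_le_cmod[of "ell2_nth x i * cnj (ell2_nth y i)"]
      by (simp only: norm_mult complex_mod_cnj real_norm_def)
    also have "\<dots> \<le> (cmod (ell2_nth x i))\<^sup>2 + (cmod (ell2_nth y i))\<^sup>2"
      using sum_squares_bound[of "cmod (ell2_nth x i)" "cmod (ell2_nth y i)"]
        mult_nonneg_nonneg[OF norm_ge_zero[of "ell2_nth x i"] norm_ge_zero[of "ell2_nth y i"]]
      by linarith
    finally show ?thesis .
  qed
qed simp

instantiation ell2 :: (type) real_inner
begin
definition inner_ell2 :: "'a ell2 \<Rightarrow> 'a ell2 \<Rightarrow> real" where
  "inner_ell2 x y = (\<Sum>\<^sub>\<infinity>i. Re (ell2_nth x i * cnj (ell2_nth y i)))"
definition norm_ell2 :: "'a ell2 \<Rightarrow> real" where "norm_ell2 x = sqrt (x \<bullet> x)"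
definition dist_ell2 :: "'a ell2 \<Rightarrow> 'a ell2 \<Rightarrow> real" where "dist_ell2 x y = norm (x - y)"
definition sgn_ell2 :: "'a ell2 \<Rightarrow> 'a ell2" where "sgn_ell2 x = inverse (norm x) *\<^sub>R x"
definition uniformity_ell2 :: "('a ell2 \<times> 'a ell2) filter" where
  "uniformity_ell2 = (INF e\<in>{0<..}. principal {(x, y). dist x y < e})"
definition open_ell2 :: "'a ell2 set \<Rightarrow> bool" where
  "open_ell2 S \<longleftrightarrow> (\<forall>x\<in>S. \<forall>\<^sub>F (x', y) in uniformity. x' = x \<longrightarrow> y \<in> S)"
instance
proof
  note sm = abs_summable_summable[OF ell2_inner_summable]
  fix x y z :: "'a ell2" and r :: real
  show "x \<bullet> y = y \<bullet> x"
    unfolding inner_ell2_def by (rule infsum_cong) simp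
  show "(x + y) \<bullet> z = x \<bullet> z + y \<bullet> z"
    using infsum_add[OF sm sm, of x z y z] by (simp add: inner_ell2_def algebra_simps)
  show "(r *\<^sub>R x) \<bullet> y = r * (x \<bullet> y)"
    using infsum_cmult_right[of r "\<lambda>i. Re (ell2_nth x i * cnj (ell2_nth y i))" UNIV] sm[of x y]
    by (simp add: inner_ell2_def algebra_simps)
  have sq: "Re (ell2_nth x i * cnj (ell2_nth x i)) = (cmod (ell2_nth x i))\<^sup>2" for i
    by (simp add: cmod_def power2_eq_square)
  show "0 \<le> x \<bullet> x"
    unfolding inner_ell2_def sq by (rule infsum_nonneg) simp
  show "x \<bullet> x = 0 \<longleftrightarrow> x = 0"
  proof
    assume "x \<bullet> x = 0"
    then have "(cmod (ell2_nth x i))\<^sup>2 = 0" for i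
      unfolding inner_ell2_def sq
      using nonneg_infsum_le_0D[OF _ ell2_summable, of x i] by simp
    then show "x = 0" by (intro ell2_eqI) simp
  qed (simp add: inner_ell2_def)
qed (simp_all add: norm_ell2_def dist_ell2_def sgn_ell2_def uniformity_ell2_def open_ell2_def)
end

lemma ell2_norm_sq: "(norm x)\<^sup>2 = (\<Sum>\<^sub>\<infinity>i. (cmod (ell2_nth x i))\<^sup>2)"
proof -
  have "Re (ell2_nth x i * cnj (ell2_nth x i)) = (cmod (ell2_nth x i))\<^sup>2" for i
    by (simp add: cmod_def power2_eq_square)
  then show ?thesis
    by (simp add: power2_norm_eq_inner inner_ell2_def)
qed

lemma ell2_sum_le: "finite F \<Longrightarrow> (\<Sum>i\<in>F. (cmod (ell2_nth x i))\<^sup>2) \<le> (norm x)\<^sup>2"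
  unfolding ell2_norm_sq by (intro finite_sum_le_infsum ell2_summable) auto

lemma ell2_nth_le: "cmod (ell2_nth x i) \<le> norm x"
proof (rule power2_le_imp_le)
  show "(cmod (ell2_nth x i))\<^sup>2 \<le> (norm x)\<^sup>2"
    using ell2_sum_le[of "{i}" x] by simp
qed simp

instance ell2 :: (type) complete_space
proof
  fix X :: "nat \<Rightarrow> 'a ell2" assume X: "Cauchy X"
  have "Cauchy (\<lambda>n. ell2_nth (X n) i)" for i
  proof (rule CauchyI)
    fix e :: real assume "e > 0"
    then obtain N where *: "\<forall>m\<ge>N. \<forall>n\<ge>N. norm (X m - X n) < e"
      using CauchyD[OF X] by blast
    then show "\<exists>N. \<forall>m\<ge>N. \<forall>n\<ge>N. norm (ell2_nth (X m) i - ell2_nth (X n) i) < e"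
    proof (intro exI[of _ N] allI impI)
      fix m n assume "m \<ge> N" "n \<ge> N"
      with * have "norm (X m - X n) < e" by blast
      then show "norm (ell2_nth (X m) i - ell2_nth (X n) i) < e"
        using ell2_nth_le[of "X m - X n" i] by simp
    qed
  qed
  then have "\<forall>i. \<exists>l. (\<lambda>n. ell2_nth (X n) i) \<longlonglongrightarrow> l"
    using Cauchy_convergent_iff convergent_def by blast
  then obtain f where f: "\<And>i. (\<lambda>n. ell2_nth (X n) i) \<longlonglongrightarrow> f i" by metis
  have bnd: "\<exists>N. \<forall>n\<ge>N. \<forall>F. finite F \<longrightarrow> (\<Sum>i\<in>F. (cmod (ell2_nth (X n) i - f i))\<^sup>2) \<le> e\<^sup>2"
    if "e > 0" for e
  proof -
    obtain N where N: "\<forall>m\<ge>N. \<forall>n\<ge>N. norm (X m - X n) < e"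
      using CauchyD[OF X \<open>e > 0\<close>] by blast
    have "(\<Sum>i\<in>F. (cmod (ell2_nth (X n) i - f i))\<^sup>2) \<le> e\<^sup>2" if "n \<ge> N" "finite F" for n F
    proof (rule Lim_bounded[where M = N])
      show "(\<lambda>m. \<Sum>i\<in>F. (cmod (ell2_nth (X n) i - ell2_nth (X m) i))\<^sup>2)
          \<longlonglongrightarrow> (\<Sum>i\<in>F. (cmod (ell2_nth (X n) i - f i))\<^sup>2)"
        by (intro tendsto_intros f)
      show "\<forall>m\<ge>N. (\<Sum>i\<in>F. (cmod (ell2_nth (X n) i - ell2_nth (X m) i))\<^sup>2) \<le> e\<^sup>2"
      proof (intro allI impI)
        fix m assume "m \<ge> N"
        have "(\<Sum>i\<in>F. (cmod (ell2_nth (X n - X m) i))\<^sup>2) \<le> (norm (X n - X m))\<^sup>2"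
          using \<open>finite F\<close> by (rule ell2_sum_le)
        also have "\<dots> \<le> e\<^sup>2"
        proof (rule power_mono)
          show "norm (X n - X m) \<le> e"
            using N[rule_format, OF \<open>n \<ge> N\<close> \<open>m \<ge> N\<close>] by simp
        qed simp
        finally show "(\<Sum>i\<in>F. (cmod (ell2_nth (X n) i - ell2_nth (X m) i))\<^sup>2) \<le> e\<^sup>2" by simp
      qed
    qed
    then show ?thesis by blast
  qed
  have sm: "(\<lambda>i. (cmod (g i))\<^sup>2) summable_on UNIV"
    if "\<And>F. finite F \<Longrightarrow> (\<Sum>i\<in>F. (cmod (g i))\<^sup>2) \<le> C" for g :: "'a \<Rightarrow> complex" and C
  proof (rule nonneg_bdd_above_summable_on)
    show "bdd_above (sum (\<lambda>i. (cmod (g i))\<^sup>2) ` {F. F \<subseteq> UNIV \<and> finite F})"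
      using that by (intro bdd_aboveI[of _ C]) (auto simp only: image_iff mem_Collect_eq)
  qed simp
  obtain N where N: "\<forall>n\<ge>N. \<forall>F. finite F \<longrightarrow> (\<Sum>i\<in>F. (cmod (ell2_nth (X n) i - f i))\<^sup>2) \<le> 1\<^sup>2"
    using bnd[OF zero_less_one] by blast
  have "(\<lambda>i. (cmod (- (ell2_nth (X N) i - f i) + ell2_nth (X N) i))\<^sup>2) summable_on UNIV"
  proof (rule ell2_add_aux[OF _ ell2_summable])
    have "(\<lambda>i. (cmod (ell2_nth (X N) i - f i))\<^sup>2) summable_on UNIV"
      by (rule sm) (rule N[rule_format, OF order_refl])
    then show "(\<lambda>i. (cmod (- (ell2_nth (X N) i - f i)))\<^sup>2) summable_on UNIV"
      by (simp only: norm_minus_cancel)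
  qed
  then have fs: "(\<lambda>i. (cmod (f i))\<^sup>2) summable_on UNIV" by simp
  define l where "l = Abs_ell2 f"
  have l: "ell2_nth l i = f i" for i
    using fs by (simp add: l_def Abs_ell2_inverse)
  have "X \<longlonglongrightarrow> l"
  proof (rule LIMSEQ_I)
    fix e :: real assume "e > 0"
    then have "e/2 > 0" by simp
    then obtain N where N: "\<forall>n\<ge>N. \<forall>F. finite F \<longrightarrow>
        (\<Sum>i\<in>F. (cmod (ell2_nth (X n) i - f i))\<^sup>2) \<le> (e/2)\<^sup>2"
      using bnd[of "e/2"] by blast
    have "norm (X n - l) < e" if "n \<ge> N" for n
    proof -
      have "(norm (X n - l))\<^sup>2 \<le> (e/2)\<^sup>2"
        unfolding ell2_norm_sq
      proof (rule infsum_le_finite_sums[OF ell2_summable])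
        fix F :: "'a set" assume "finite F"
        then show "(\<Sum>i\<in>F. (cmod (ell2_nth (X n - l) i))\<^sup>2) \<le> (e/2)\<^sup>2"
          using N \<open>n \<ge> N\<close> by (simp only: ell2_nth_simps l)
      qed
      then have "norm (X n - l) \<le> e/2"
        by (rule power2_le_imp_le) (use \<open>e > 0\<close> in simp)
      then show ?thesis using \<open>e > 0\<close> by linarith
    qed
    then show "\<exists>N. \<forall>n\<ge>N. norm (X n - l) < e" by blast
  qed
  then show "convergent X" unfolding convergent_def by (rule exI)
qed

instance ell2 :: (type) banach ..

section \<open>The Lie superalgebra\<close>

text \<open>
  \<open>u_+\<close> and \<open>u_-\<close> are the basis vectors with index 1 and 2, and \<open>s $ i $ j $ k\<close> is the
  coefficient of \<open>u_i \<otimes> u_j \<otimes> u_k\<close> in the odd element \<open>s\<close>.  The type \<open>lie\<close> is larger than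
  the Lie superalgebra: the even components have to be restricted to \<open>sl3\<close>.
\<close>

type_synonym mat2 = "real ^ 2 ^ 2"
type_synonym mat2x3 = "mat2 \<times> mat2 \<times> mat2"
type_synonym tensor = "real ^ 2 ^ 2 ^ 2"
type_synonym lie = "mat2x3 \<times> tensor"

definition sl3 :: "mat2x3 set" where
  "sl3 = {(X1, X2, X3). trace X1 = 0 \<and> trace X2 = 0 \<and> trace X3 = 0}"

definition tensor :: "real ^ 2 \<Rightarrow> real ^ 2 \<Rightarrow> real ^ 2 \<Rightarrow> tensor" where
  "tensor x y z = (\<chi> i j k. x $ i * y $ j * z $ k)"

abbreviation ub :: "2 \<Rightarrow> real ^ 2" where "ub i \<equiv> axis i 1"

definition \<psi> :: "real ^ 2 \<Rightarrow> real ^ 2 \<Rightarrow> real" where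
  "\<psi> x y = x $ 1 * y $ 2 - x $ 2 * y $ 1"

definition pmap :: "real ^ 2 \<Rightarrow> real ^ 2 \<Rightarrow> mat2" where
  "pmap x y = matrix (\<lambda>z. \<psi> y z *\<^sub>R x - \<psi> z x *\<^sub>R y)"

definition commutator :: "mat2 \<Rightarrow> mat2 \<Rightarrow> mat2" where
  "commutator X Y = X ** Y - Y ** X"

fun even_bracket :: "mat2x3 \<Rightarrow> mat2x3 \<Rightarrow> mat2x3" where
  "even_bracket (X1, X2, X3) (Y1, Y2, Y3) =
     (commutator X1 Y1, commutator X2 Y2, commutator X3 Y3)"

fun lie_act :: "mat2x3 \<Rightarrow> tensor \<Rightarrow> tensor" where
  "lie_act (X1, X2, X3) s = (\<Sum>i\<in>UNIV. \<Sum>j\<in>UNIV. \<Sum>k\<in>UNIV. s $ i $ j $ k *\<^sub>R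
     (tensor (X1 *v ub i) (ub j) (ub k) + tensor (ub i) (X2 *v ub j) (ub k)
       + tensor (ub i) (ub j) (X3 *v ub k)))"

text \<open>The bracket of the pure tensors \<open>x1 \<otimes> x2 \<otimes> x3\<close> and \<open>y1 \<otimes> y2 \<otimes> y3\<close>.\<close>

definition tensor_bracket :: "real \<Rightarrow> real ^ 2 \<Rightarrow> real ^ 2 \<Rightarrow> real ^ 2 \<Rightarrow>
    real ^ 2 \<Rightarrow> real ^ 2 \<Rightarrow> real ^ 2 \<Rightarrow> mat2x3" where
  "tensor_bracket \<alpha> x1 x2 x3 y1 y2 y3 =
     (((1 + \<alpha>) / 2 * \<psi> x2 y2 * \<psi> x3 y3) *\<^sub>R pmap x1 y1,
      (- 1 / 2 * \<psi> x3 y3 * \<psi> x1 y1) *\<^sub>R pmap x2 y2,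
      (- \<alpha> / 2 * \<psi> x1 y1 * \<psi> x2 y2) *\<^sub>R pmap x3 y3)"

definition odd_bracket :: "real \<Rightarrow> tensor \<Rightarrow> tensor \<Rightarrow> mat2x3" where
  "odd_bracket \<alpha> s t =
     (\<Sum>i\<in>UNIV. \<Sum>j\<in>UNIV. \<Sum>k\<in>UNIV. \<Sum>l\<in>UNIV. \<Sum>m\<in>UNIV. \<Sum>n\<in>UNIV.
       (s $ i $ j $ k * t $ l $ m $ n) *\<^sub>R tensor_bracket \<alpha> (ub i) (ub j) (ub k) (ub l) (ub m) (ub n))"

fun lie_bracket :: "real \<Rightarrow> lie \<Rightarrow> lie \<Rightarrow> lie" where
  "lie_bracket \<alpha> (X, s) (Y, t) =
     (even_bracket X Y + odd_bracket \<alpha> s t, lie_act X t - lie_act Y s)"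


lemma lie_act_tensor:
  "lie_act (X1, X2, X3) (tensor x y z) =
     tensor (X1 *v x) y z + tensor x (X2 *v y) z + tensor x y (X3 *v z)"
  by (simp add: vec_eq_iff tensor_def forall_2 sum_2 axis_def matrix_vector_mult_def algebra_simps)

lemma odd_bracket_tensor:
  "odd_bracket \<alpha> (tensor x1 x2 x3) (tensor y1 y2 y3) = tensor_bracket \<alpha> x1 x2 x3 y1 y2 y3"
proof -
  have p: "pmap x y = (\<chi> i j. x $ i * (if j = 1 then - y $ 2 else y $ 1) + y $ i * (if j = 1 then - x $ 2 else x $ 1))" for x y
    by (simp add: pmap_def matrix_def \<psi>_def vec_eq_iff forall_2 axis_def)
  show ?thesis
  by (simp add: odd_bracket_def tensor_bracket_def tensor_def sum_2 \<psi>_def p axis_def prod_eq_iff vec_eq_iff forall_2 field_simps)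
qed

section \<open>The representation on the polynomial Fock space\<close>

definition rho_F1 where "rho_F1 p = 2 *\<^sub>R (z3 * d4 p)"
definition rho_E1 where "rho_E1 p = (1/2) *\<^sub>R (z4 * d3 p)"
definition rho_H1 where "rho_H1 p = z4 * d4 p - z3 * d3 p"
definition rho_F2 where "rho_F2 \<alpha> p = - (\<i>/2) *\<^sub>C (z1 * p + B1 \<alpha> p)
  - (\<i>/2) *\<^sub>C ((- \<alpha>) *\<^sub>R p + 2 *\<^sub>R (z1 * d1 p) + z3 * d3 p + z4 * d4 p)"
definition rho_E2 where "rho_E2 \<alpha> p = - (\<i>/2) *\<^sub>C (z1 * p + B1 \<alpha> p)
  + (\<i>/2) *\<^sub>C ((- \<alpha>) *\<^sub>R p + 2 *\<^sub>R (z1 * d1 p) + z3 * d3 p + z4 * d4 p)"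
definition rho_H2 where "rho_H2 \<alpha> p = z1 * p - B1 \<alpha> p"
definition rho_F3 where "rho_F3 p = - (\<i>/2) *\<^sub>C (z2 * p + B2 p)
  - (\<i>/2) *\<^sub>C (- p + 2 *\<^sub>R (z2 * d2 p) + z3 * d3 p + z4 * d4 p)"
definition rho_E3 where "rho_E3 p = - (\<i>/2) *\<^sub>C (z2 * p + B2 p)
  + (\<i>/2) *\<^sub>C (- p + 2 *\<^sub>R (z2 * d2 p) + z3 * d3 p + z4 * d4 p)"
definition rho_H3 where "rho_H3 p = z2 * p - B2 p"

definition rho_mmm where "rho_mmm \<alpha> p = (\<i>/2) *\<^sub>C (z3 * p + B3 \<alpha> p)
  + (\<i>/2) *\<^sub>C (z3 * d1 p + (2 * \<alpha>) *\<^sub>R (z2 * d4 p) + z3 * d2 p + 2 *\<^sub>R (z1 * d4 p))"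
definition rho_mpp where "rho_mpp \<alpha> p = - (\<i>/2) *\<^sub>C (z3 * p + B3 \<alpha> p)
  + (\<i>/2) *\<^sub>C (z3 * d1 p + (2 * \<alpha>) *\<^sub>R (z2 * d4 p) + z3 * d2 p + 2 *\<^sub>R (z1 * d4 p))"
definition rho_pmm where "rho_pmm \<alpha> p = (\<i>/4) *\<^sub>C (z4 * p + B4 \<alpha> p)
  + (\<i>/4) *\<^sub>C (z4 * d1 p - (2 * \<alpha>) *\<^sub>R (z2 * d3 p) + z4 * d2 p - 2 *\<^sub>R (z1 * d3 p))"
definition rho_ppp where "rho_ppp \<alpha> p = - (\<i>/4) *\<^sub>C (z4 * p + B4 \<alpha> p)
  + (\<i>/4) *\<^sub>C (z4 * d1 p - (2 * \<alpha>) *\<^sub>R (z2 * d3 p) + z4 * d2 p - 2 *\<^sub>R (z1 * d3 p))"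

text \<open>Actions of \<open>u_--+ \<plusminus> u_-+-\<close> and \<open>u_+-+ \<plusminus> u_++-\<close>.\<close>

definition rho_m_sum where "rho_m_sum \<alpha> p = - (z3 * p - B3 \<alpha> p)"
definition rho_m_diff where "rho_m_diff \<alpha> p =
  - (z3 * d1 p) - (2 * \<alpha>) *\<^sub>R (z2 * d4 p) + z3 * d2 p + 2 *\<^sub>R (z1 * d4 p)"
definition rho_p_sum where "rho_p_sum \<alpha> p = (- 1/2) *\<^sub>R (z4 * p - B4 \<alpha> p)"
definition rho_p_diff where "rho_p_diff \<alpha> p = (1/2) *\<^sub>R
  (- (z4 * d1 p) + (2 * \<alpha>) *\<^sub>R (z2 * d3 p) + z4 * d2 p - 2 *\<^sub>R (z1 * d3 p))"

lemmas rho_even_defs = rho_F1_def rho_E1_def rho_H1_def rho_F2_def rho_E2_def rho_H2_def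
  rho_F3_def rho_E3_def rho_H3_def
lemmas rho_odd_defs = rho_mmm_def rho_mpp_def rho_pmm_def rho_ppp_def rho_m_sum_def
  rho_m_diff_def rho_p_sum_def rho_p_diff_def

text \<open>For traceless \<open>X\<close> one has \<open>X = X$1$1 H + X$1$2 E + X$2$1 F\<close>.\<close>

fun rho_sp :: "real \<Rightarrow> lie \<Rightarrow> spoly \<Rightarrow> spoly" where
  "rho_sp \<alpha> ((X1, X2, X3), s) p =
     X1$1$1 *\<^sub>R rho_H1 p + X1$1$2 *\<^sub>R rho_E1 p + X1$2$1 *\<^sub>R rho_F1 p
     + X2$1$1 *\<^sub>R rho_H2 \<alpha> p + X2$1$2 *\<^sub>R rho_E2 \<alpha> p + X2$2$1 *\<^sub>R rho_F2 \<alpha> p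
     + X3$1$1 *\<^sub>R rho_H3 p + X3$1$2 *\<^sub>R rho_E3 p + X3$2$1 *\<^sub>R rho_F3 p
     + s$1$1$1 *\<^sub>R rho_ppp \<alpha> p + s$1$2$2 *\<^sub>R rho_pmm \<alpha> p
     + s$1$2$1 *\<^sub>R (1/2) *\<^sub>R (rho_p_sum \<alpha> p + rho_p_diff \<alpha> p)
     + s$1$1$2 *\<^sub>R (1/2) *\<^sub>R (rho_p_sum \<alpha> p - rho_p_diff \<alpha> p)
     + s$2$1$1 *\<^sub>R rho_mpp \<alpha> p + s$2$2$2 *\<^sub>R rho_mmm \<alpha> p
     + s$2$2$1 *\<^sub>R (1/2) *\<^sub>R (rho_m_sum \<alpha> p + rho_m_diff \<alpha> p)
     + s$2$1$2 *\<^sub>R (1/2) *\<^sub>R (rho_m_sum \<alpha> p - rho_m_diff \<alpha> p)"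

lemma rho_sp_diff: "rho_sp \<alpha> X (p - q) = rho_sp \<alpha> X p - rho_sp \<alpha> X q"
proof -
  have ev: "rho_F1 (p - q) = rho_F1 p - rho_F1 q" "rho_E1 (p - q) = rho_E1 p - rho_E1 q"
    "rho_H1 (p - q) = rho_H1 p - rho_H1 q" "rho_F2 \<alpha> (p - q) = rho_F2 \<alpha> p - rho_F2 \<alpha> q"
    "rho_E2 \<alpha> (p - q) = rho_E2 \<alpha> p - rho_E2 \<alpha> q" "rho_H2 \<alpha> (p - q) = rho_H2 \<alpha> p - rho_H2 \<alpha> q"
    "rho_F3 (p - q) = rho_F3 p - rho_F3 q" "rho_E3 (p - q) = rho_E3 p - rho_E3 q"
    "rho_H3 (p - q) = rho_H3 p - rho_H3 q"
    by (simp_all add: rho_even_defs d_diff B_diff scaleC_diff_right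
        scaleC_add_right scaleC_uminus_right algebra_simps)
  have od: "rho_mmm \<alpha> (p - q) = rho_mmm \<alpha> p - rho_mmm \<alpha> q"
    "rho_mpp \<alpha> (p - q) = rho_mpp \<alpha> p - rho_mpp \<alpha> q"
    "rho_pmm \<alpha> (p - q) = rho_pmm \<alpha> p - rho_pmm \<alpha> q"
    "rho_ppp \<alpha> (p - q) = rho_ppp \<alpha> p - rho_ppp \<alpha> q"
    "rho_m_sum \<alpha> (p - q) = rho_m_sum \<alpha> p - rho_m_sum \<alpha> q"
    "rho_m_diff \<alpha> (p - q) = rho_m_diff \<alpha> p - rho_m_diff \<alpha> q"
    "rho_p_sum \<alpha> (p - q) = rho_p_sum \<alpha> p - rho_p_sum \<alpha> q"
    "rho_p_diff \<alpha> (p - q) = rho_p_diff \<alpha> p - rho_p_diff \<alpha> q"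
    by (simp_all add: rho_odd_defs d_diff B_diff scaleC_diff_right
        scaleC_add_right scaleC_uminus_right algebra_simps)
  obtain X1 X2 X3 s where "X = ((X1, X2, X3), s)" by (metis surj_pair)
  then show ?thesis
    by (simp add: ev od scaleR_diff_right scaleR_add_right)
qed

lemma rho_pieces_ideal:
  assumes "p \<in> fock_ideal"
  shows "z3 * d4 p \<in> fock_ideal" "z4 * d3 p \<in> fock_ideal" "z4 * d4 p - z3 * d3 p \<in> fock_ideal"
    "2 *\<^sub>R (z1 * d1 p) + z3 * d3 p + z4 * d4 p \<in> fock_ideal"
    "2 *\<^sub>R (z2 * d2 p) + z3 * d3 p + z4 * d4 p \<in> fock_ideal"
    "z3 * d1 p + (2 * \<alpha>) *\<^sub>R (z2 * d4 p) \<in> fock_ideal"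
    "z3 * d2 p + 2 *\<^sub>R (z1 * d4 p) \<in> fock_ideal"
    "z4 * d1 p - (2 * \<alpha>) *\<^sub>R (z2 * d3 p) \<in> fock_ideal"
    "z4 * d2 p - 2 *\<^sub>R (z1 * d3 p) \<in> fock_ideal"
  using assms
  by (simp_all add: fock_ideal_iff coeff_pderiv pderiv_pCons pderiv_smult two_mult_smult
      coeff_two_mult smult_add_right)

lemma rho_sp_ideal:
  assumes p: "p \<in> fock_ideal"
  shows "rho_sp \<alpha> X p \<in> fock_ideal"
proof -
  note pc = rho_pieces_ideal[OF p]
  have eq: "a + b + c + d = a + (b + c + d)" for a b c d :: spoly by (simp add: algebra_simps)
  note cl = fock_ideal.mult_left[OF p] fock_ideal_closed
  have ev: "rho_F1 p \<in> fock_ideal" "rho_E1 p \<in> fock_ideal" "rho_H1 p \<in> fock_ideal"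
    "rho_F2 \<alpha> p \<in> fock_ideal" "rho_E2 \<alpha> p \<in> fock_ideal" "rho_H2 \<alpha> p \<in> fock_ideal"
    "rho_F3 p \<in> fock_ideal" "rho_E3 p \<in> fock_ideal" "rho_H3 p \<in> fock_ideal"
    unfolding rho_even_defs eq
    by (intro pc cl p B_ideal[OF p])+
  have e1: "z3 * d1 p + (2 * \<alpha>) *\<^sub>R (z2 * d4 p) + z3 * d2 p + 2 *\<^sub>R (z1 * d4 p) =
      (z3 * d1 p + (2 * \<alpha>) *\<^sub>R (z2 * d4 p)) + (z3 * d2 p + 2 *\<^sub>R (z1 * d4 p))" by simp
  have e2: "z4 * d1 p - (2 * \<alpha>) *\<^sub>R (z2 * d3 p) + z4 * d2 p - 2 *\<^sub>R (z1 * d3 p) =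
      (z4 * d1 p - (2 * \<alpha>) *\<^sub>R (z2 * d3 p)) + (z4 * d2 p - 2 *\<^sub>R (z1 * d3 p))" by simp
  have e3: "- (z3 * d1 p) - (2 * \<alpha>) *\<^sub>R (z2 * d4 p) + z3 * d2 p + 2 *\<^sub>R (z1 * d4 p) =
      (z3 * d2 p + 2 *\<^sub>R (z1 * d4 p)) - (z3 * d1 p + (2 * \<alpha>) *\<^sub>R (z2 * d4 p))" by simp
  have e4: "- (z4 * d1 p) + (2 * \<alpha>) *\<^sub>R (z2 * d3 p) + z4 * d2 p - 2 *\<^sub>R (z1 * d3 p) =
      (z4 * d2 p - 2 *\<^sub>R (z1 * d3 p)) - (z4 * d1 p - (2 * \<alpha>) *\<^sub>R (z2 * d3 p))" by simp
  have od: "rho_mmm \<alpha> p \<in> fock_ideal" "rho_mpp \<alpha> p \<in> fock_ideal" "rho_pmm \<alpha> p \<in> fock_ideal"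
    "rho_ppp \<alpha> p \<in> fock_ideal" "rho_m_sum \<alpha> p \<in> fock_ideal" "rho_m_diff \<alpha> p \<in> fock_ideal"
    "rho_p_sum \<alpha> p \<in> fock_ideal" "rho_p_diff \<alpha> p \<in> fock_ideal"
    unfolding rho_odd_defs e1 e2 e3 e4
    by (intro fock_ideal.add[OF pc(6,7)] fock_ideal.add[OF pc(8,9)] fock_ideal_diff[OF pc(7,6)]
        fock_ideal_diff[OF pc(9,8)] cl B_ideal[OF p] p)+
  obtain X1 X2 X3 s where "X = ((X1, X2, X3), s)" by (metis surj_pair)
  then show ?thesis
    by (auto intro!: fock_ideal.add fock_ideal_scaleR fock_ideal_diff ev od)
qed

lift_definition drho :: "real \<Rightarrow> lie \<Rightarrow> fock_poly \<Rightarrow> fock_poly" is rho_sp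
  unfolding fock_eq_def using rho_sp_ideal by (simp flip: rho_sp_diff)

section \<open>The Fock space\<close>

text \<open>\<open>(k, G1)\<close>, \<open>(k, G2)\<close>, \<open>(k, G3)\<close>, \<open>(k, G4)\<close> index the classes of \<open>z1^k\<close>, \<open>z1^k z2\<close>,
  \<open>z1^k z3\<close>, \<open>z1^k z4\<close>.\<close>

datatype fock_gen = G1 | G2 | G3 | G4

type_synonym fock_idx = "nat \<times> fock_gen"

fun gen_sp :: "fock_gen \<Rightarrow> spoly" where
  "gen_sp G1 = 1" | "gen_sp G2 = z2" | "gen_sp G3 = z3" | "gen_sp G4 = z4"

lift_definition fock_basis :: "fock_idx \<Rightarrow> fock_poly" is
  "\<lambda>i. z1 ^ fst i * gen_sp (snd i)" .

fun nf_poly :: "spoly \<Rightarrow> fock_gen \<Rightarrow> complex poly" where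
  "nf_poly p G1 = coeff (sp0 p) 0"
| "nf_poly p G2 = coeff (sp0 p) 1 - [:0, 2:] * coeff (sp34 p) 0"
| "nf_poly p G3 = coeff (sp3 p) 0"
| "nf_poly p G4 = coeff (sp4 p) 0"

lemma fock_ideal_nf: "p \<in> fock_ideal \<longleftrightarrow> (\<forall>g. nf_poly p g = 0)"
proof
  assume "\<forall>g. nf_poly p g = 0"
  then have "nf_poly p G1 = 0" "nf_poly p G2 = 0" "nf_poly p G3 = 0" "nf_poly p G4 = 0" by blast+
  then show "p \<in> fock_ideal" unfolding fock_ideal_iff nf_poly.simps by (simp only: right_minus_eq simp_thms)
next
  assume "p \<in> fock_ideal"
  then show "\<forall>g. nf_poly p g = 0"
    unfolding fock_ideal_iff by (intro allI, case_tac g) (simp_all only: nf_poly.simps diff_self)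
qed

lemma nf_poly_linear:
  "nf_poly 0 g = 0" "nf_poly (p + q) g = nf_poly p g + nf_poly q g"
  "nf_poly (p - q) g = nf_poly p g - nf_poly q g" "nf_poly (c *\<^sub>C p) g = smult c (nf_poly p g)"
  by (cases g; simp add: algebra_simps smult_diff_right; simp add: mult.commute[of c])+

text \<open>Coordinates with respect to the basis \<open>fock_basis\<close>.\<close>

lift_definition fock_coord :: "fock_poly \<Rightarrow> fock_idx \<Rightarrow> complex" is
  "\<lambda>p i. coeff (nf_poly p (snd i)) (fst i)"
  by (simp add: fock_eq_def fock_ideal_nf nf_poly_linear fun_eq_iff)

lemma z1_pow: "z1 ^ k * p = SP (smult (monom 1 k) (sp0 p)) (smult (monom 1 k) (sp3 p))
    (smult (monom 1 k) (sp4 p)) (smult (monom 1 k) (sp34 p))"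
  by (induction k) (auto simp: monom_Suc mult.assoc intro!: spoly_eqI)

lemma fock_coord_basis: "fock_coord (fock_basis i) j = of_bool (i = j)"
proof -
  have 1: "sp0 1 = 1" "sp3 1 = 0" "sp4 1 = 0" "sp34 1 = 0" by (simp_all add: one_spoly_def)
  have zk: "z1 ^ k = SP [:monom 1 k:] 0 0 0" for k
    using z1_pow[of k 1] by (simp add: 1)
  have "nf_poly (z1 ^ k * gen_sp g) h = (if g = h then monom 1 k else 0)" for k g h
    unfolding zk
    by (cases g; cases h; simp add: 1 z2_def z3_def z4_def times_spoly_def)
  moreover have "fock_coord (fock_basis i) j =
      coeff (nf_poly (z1 ^ fst i * gen_sp (snd i)) (snd j)) (fst j)"
    by (simp only: fock_basis.abs_eq fock_coord.abs_eq)
  ultimately have "fock_coord (fock_basis i) j =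
      coeff (if snd i = snd j then monom 1 (fst i) else 0) (fst j)"
    by (simp only:)
  then show ?thesis
    by (auto simp: prod_eq_iff)
qed

lemma fock_coord_linear [simp]:
  "fock_coord 0 i = 0"
  "fock_coord (p + q) i = fock_coord p i + fock_coord q i"
  "fock_coord (p - q) i = fock_coord p i - fock_coord q i"
  "fock_coord (c *\<^sub>C p) i = c * fock_coord p i"
  by (transfer; simp add: nf_poly_linear)+

lemma UNIV_fock_gen: "(UNIV :: fock_gen set) = {G1, G2, G3, G4}"
  using fock_gen.exhaust by auto

lemma finite_fock_coord: "finite {i. fock_coord p i \<noteq> 0}"
proof (transfer, goal_cases)
  case (1 p)
  have fin: "finite (\<Union>g. (\<lambda>k. (k, g)) ` {k. coeff (nf_poly p g) k \<noteq> 0})"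
  proof (rule finite_UN_I)
    show "finite (UNIV :: fock_gen set)" by (simp add: UNIV_fock_gen)
    show "finite ((\<lambda>k. (k, g)) ` {k. coeff (nf_poly p g) k \<noteq> 0})" for g
      using MOST_coeff_eq_0[of "nf_poly p g"] by (simp add: eventually_cofinite)
  qed
  show ?case
    by (rule finite_subset[OF _ fin]) (auto simp: image_iff)
qed

lemma fock_poly_eqI:
  assumes "\<And>i. fock_coord p i = fock_coord q i"
  shows "p = q"
  using assms
proof (transfer, goal_cases)
  case (1 p q)
  then have "nf_poly p g = nf_poly q g" for g
    by (intro poly_eqI) (metis fst_conv snd_conv)
  then show ?case by (simp add: fock_eq_def fock_ideal_nf nf_poly_linear)
qed

lemma scaleC_sum_right: "c *\<^sub>C sum f S = (\<Sum>i\<in>S. c *\<^sub>C (f i :: 'a::complex_vector))"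
  by (induction S rule: infinite_finite_induct) (simp_all add: scaleC_add_right)

lemma fock_coord_sum: "fock_coord (sum f S) i = (\<Sum>x\<in>S. fock_coord (f x) i)"
  by (induction S rule: infinite_finite_induct) auto

lemma fock_poly_expand:
  "p = (\<Sum>i | fock_coord p i \<noteq> 0. fock_coord p i *\<^sub>C fock_basis i)"
  by (rule fock_poly_eqI)
    (simp add: fock_coord_sum fock_coord_basis of_bool_def if_distrib finite_fock_coord cong: if_cong)


text \<open>
  The Fock space is realised by the coordinates in the orthonormal basis obtained by
  normalising the basis of monomials: \<open>fock_weight \<alpha> i\<close> is the square norm of the \<open>i\<close>-th
  monomial for the inner product \<open>(\<cdot>,\<cdot>)_S\<close>, and \<open>fock_embed \<alpha>\<close> is the embedding of the
  polynomial Fock space into its completion.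
\<close>

type_synonym fock = "fock_idx ell2"

fun fock_weight :: "real \<Rightarrow> fock_idx \<Rightarrow> real" where
  "fock_weight \<alpha> (k, G1) = fact k * \<bar>pochhammer (- \<alpha>) k\<bar>"
| "fock_weight \<alpha> (k, G2) = fact k * \<bar>pochhammer (- \<alpha>) k\<bar>"
| "fock_weight \<alpha> (k, G3) = 2 * fact k * \<bar>pochhammer (- \<alpha>) (k + 1)\<bar>"
| "fock_weight \<alpha> (k, G4) = 2 * fact k * \<bar>pochhammer (- \<alpha>) (k + 1)\<bar>"

lift_definition fock_embed :: "real \<Rightarrow> fock_poly \<Rightarrow> fock" is
  "\<lambda>\<alpha> p i. complex_of_real (sqrt (fock_weight \<alpha> i)) * fock_coord p i"
proof -
  fix \<alpha> p
  have "(\<lambda>i. (cmod (complex_of_real (sqrt (fock_weight \<alpha> i)) * fock_coord p i))\<^sup>2)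
      summable_on {i. fock_coord p i \<noteq> 0}"
    by (rule summable_on_finite[OF finite_fock_coord])
  then show "(\<lambda>i. (cmod (complex_of_real (sqrt (fock_weight \<alpha> i)) * fock_coord p i))\<^sup>2)
      summable_on UNIV"
    by (rule summable_on_cong_neutral[THEN iffD1, rotated -1]) auto
qed

lemma fock_weight_pos: "\<alpha> \<notin> \<nat> \<Longrightarrow> fock_weight \<alpha> i > 0"
proof -
  assume "\<alpha> \<notin> \<nat>"
  then have "pochhammer (- \<alpha>) k \<noteq> 0" for k
    by (auto simp: pochhammer_eq_0_iff)
  then show ?thesis
    by (cases "(\<alpha>, i)" rule: fock_weight.cases) auto
qed

lemma ell2_nth_embed:
  "ell2_nth (fock_embed \<alpha> p) i = complex_of_real (sqrt (fock_weight \<alpha> i)) * fock_coord p i"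
  by (simp add: fock_embed.rep_eq)

lemma norm_fock_embed:
  assumes "\<alpha> \<notin> \<nat>"
  shows "(norm (fock_embed \<alpha> p))\<^sup>2 =
    (\<Sum>i | fock_coord p i \<noteq> 0. fock_weight \<alpha> i * (cmod (fock_coord p i))\<^sup>2)"
proof -
  have "(norm (fock_embed \<alpha> p))\<^sup>2 = (\<Sum>\<^sub>\<infinity>i. fock_weight \<alpha> i * (cmod (fock_coord p i))\<^sup>2)"
    unfolding ell2_norm_sq ell2_nth_embed norm_mult power_mult_distrib
    using fock_weight_pos[OF assms] by (intro infsum_cong) (simp add: less_imp_le)
  also have "\<dots> = (\<Sum>\<^sub>\<infinity>i\<in>{i. fock_coord p i \<noteq> 0}. fock_weight \<alpha> i * (cmod (fock_coord p i))\<^sup>2)"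
    by (rule infsum_cong_neutral) auto
  finally show ?thesis
    by (simp add: infsum_finite finite_fock_coord)
qed

lemma closure_fock_embed:
  assumes "\<alpha> \<notin> \<nat>"
  shows "closure (range (fock_embed \<alpha>)) = UNIV"
proof -
  have "x \<in> closure (range (fock_embed \<alpha>))" for x :: fock
    unfolding closure_approachable
  proof (intro allI impI)
    fix e :: real assume "e > 0"
    let ?f = "\<lambda>i. (cmod (ell2_nth x i))\<^sup>2"
    have "(?f has_sum (norm x)\<^sup>2) UNIV"
      unfolding ell2_norm_sq by (rule has_sum_infsum[OF ell2_summable])
    then have "eventually (\<lambda>F. dist (sum ?f F) ((norm x)\<^sup>2) < e\<^sup>2) (finite_subsets_at_top UNIV)"
      unfolding has_sum_def by (rule tendstoD) (use \<open>e > 0\<close> in simp)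
    then obtain F where F: "finite F" "dist (sum ?f F) ((norm x)\<^sup>2) < e\<^sup>2"
      unfolding eventually_finite_subsets_at_top by blast
    define p where "p = (\<Sum>i\<in>F. (ell2_nth x i / complex_of_real (sqrt (fock_weight \<alpha> i))) *\<^sub>C fock_basis i)"
    have "fock_coord p i = (if i \<in> F then ell2_nth x i / complex_of_real (sqrt (fock_weight \<alpha> i)) else 0)" for i
      using F(1) by (simp add: p_def fock_coord_sum fock_coord_basis of_bool_def if_distrib cong: if_cong)
    moreover have "complex_of_real (sqrt (fock_weight \<alpha> i)) \<noteq> 0" for i
      using fock_weight_pos[OF assms, of i] by simp
    ultimately have nth: "ell2_nth (fock_embed \<alpha> p) i = (if i \<in> F then ell2_nth x i else 0)" for i
      by (simp add: ell2_nth_embed)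
    have "(norm (x - fock_embed \<alpha> p))\<^sup>2 = (\<Sum>\<^sub>\<infinity>i. if i \<in> F then 0 else ?f i)"
      unfolding ell2_norm_sq by (intro infsum_cong) (simp add: nth)
    also have "\<dots> = (\<Sum>\<^sub>\<infinity>i\<in>UNIV - F. ?f i)"
      by (rule infsum_cong_neutral) auto
    also have "\<dots> = (norm x)\<^sup>2 - sum ?f F"
      using infsum_Diff[OF ell2_summable summable_on_finite[OF F(1)] subset_UNIV, of x]
      by (simp only: ell2_norm_sq infsum_finite[OF F(1)])
    also have "\<dots> < e\<^sup>2" using F(2) by (simp add: dist_real_def)
    finally have "norm (x - fock_embed \<alpha> p) < e"
      by (rule power2_less_imp_less) (use \<open>e > 0\<close> in simp)
    then have "dist (fock_embed \<alpha> p) x < e"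
      by (simp only: dist_norm norm_minus_commute)
    then show "\<exists>y\<in>range (fock_embed \<alpha>). dist y x < e" by blast
  qed
  then show ?thesis by blast
qed

text \<open>The continuous extension of the Bessel--Fischer product, written in the monomial basis.\<close>

definition fock_form :: "real \<Rightarrow> fock \<Rightarrow> fock \<Rightarrow> complex" where
  "fock_form \<alpha> x y = (\<Sum>\<^sub>\<infinity>(i, j).
     ell2_nth x i / complex_of_real (sqrt (fock_weight \<alpha> i)) *
     cnj (ell2_nth y j / complex_of_real (sqrt (fock_weight \<alpha> j))) *
     bessel_fischer \<alpha> (fock_basis i) (fock_basis j))"

definition fock_grade :: "nat \<Rightarrow> fock set" where
  "fock_grade a = {x. \<forall>k. if a = 0 then ell2_nth x (k, G3) = 0 \<and> ell2_nth x (k, G4) = 0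
     else ell2_nth x (k, G1) = 0 \<and> ell2_nth x (k, G2) = 0}"

lemma sp_const_linear: "sp_const (p + q) = sp_const p + sp_const q" "sp_const (c *\<^sub>C p) = c * sp_const p"
  by (simp_all add: sp_const_def)

lemma eval1_scale: "eval1 A (smult c r) v = c *\<^sub>C eval1 A r v"
proof -
  have "eval1 A (smult c r) v = (\<Sum>a\<le>degree r. coeff (smult c r) a *\<^sub>C (A ^^ a) v)"
    by (rule eval1_bound) simp
  also have "\<dots> = (\<Sum>a\<le>degree r. c *\<^sub>C (coeff r a *\<^sub>C (A ^^ a) v))"
    by (simp add: scaleC_scaleC)
  also have "\<dots> = c *\<^sub>C eval1 A r v"
    by (simp add: eval1_def scaleC_sum_right)
  finally show ?thesis .
qed

lemma eval2_scale: "eval2 A B (smult [:c:] p) v = c *\<^sub>C eval2 A B p v"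
proof -
  have "eval2 A B (smult [:c:] p) v = (\<Sum>b\<le>degree p. eval1 A (coeff (smult [:c:] p) b) ((B ^^ b) v))"
    by (rule eval2_bound) simp
  also have "\<dots> = c *\<^sub>C eval2 A B p v"
    by (simp add: eval2_def eval1_scale scaleC_sum_right)
  finally show ?thesis .
qed

lemma bessel_subst_scale_left: "bessel_subst \<alpha> (c *\<^sub>C p) q = c *\<^sub>C bessel_subst \<alpha> p q"
  by (simp add: bessel_subst_def eval2_scale scaleC_add_right)

lemma funpow_scaleC:
  fixes A :: "spoly \<Rightarrow> spoly"
  assumes "\<And>x. A (c *\<^sub>C x) = c *\<^sub>C A x"
  shows "(A ^^ n) (c *\<^sub>C x) = c *\<^sub>C (A ^^ n) x"
  by (induction n) (simp_all add: assms)

lemma eval2_scale_right: "eval2 (B1 \<alpha>) B2 p (c *\<^sub>C v) = c *\<^sub>C eval2 (B1 \<alpha>) B2 p v"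
  by (simp add: eval2_def eval1_def funpow_scaleC[of "B1 \<alpha>", OF B_scaleC(1)]
      funpow_scaleC[of B2, OF B_scaleC(2)] scaleC_sum_right scaleC_scaleC mult.commute)

lemma bessel_subst_scale_right: "bessel_subst \<alpha> p (c *\<^sub>C q) = c *\<^sub>C bessel_subst \<alpha> p q"
  by (simp add: bessel_subst_def eval2_scale_right B_scaleC scaleC_add_right)

lemma sp_cnj_scale: "sp_cnj (c *\<^sub>C p) = cnj c *\<^sub>C sp_cnj p"
  by (rule spoly_eqI) (auto simp: sp_cnj_def coeff_map_poly map_poly_smult intro!: poly_eqI)

lemma bessel_fischer_diff:
  "bessel_fischer \<alpha> (p - p') q = bessel_fischer \<alpha> p q - bessel_fischer \<alpha> p' q"
  "bessel_fischer \<alpha> p (q - q') = bessel_fischer \<alpha> p q - bessel_fischer \<alpha> p q'"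
  by (transfer; simp add: bessel_subst_diff_left bessel_subst_diff_right sp_cnj_diff sp_const_diff)+

lemma bessel_fischer_zero: "bessel_fischer \<alpha> 0 q = 0" "bessel_fischer \<alpha> p 0 = 0"
  using bessel_fischer_diff(1)[of \<alpha> 0 0 q] bessel_fischer_diff(2)[of \<alpha> p 0 0] by simp_all

lemma bessel_fischer_add:
  "bessel_fischer \<alpha> (p + p') q = bessel_fischer \<alpha> p q + bessel_fischer \<alpha> p' q"
  "bessel_fischer \<alpha> p (q + q') = bessel_fischer \<alpha> p q + bessel_fischer \<alpha> p q'"
  subgoal using bessel_fischer_diff(1)[of \<alpha> "p + p'" p' q] by simp
  subgoal using bessel_fischer_diff(2)[of \<alpha> p "q + q'" q'] by simp
  done

lemma bessel_fischer_scale: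
  "bessel_fischer \<alpha> (c *\<^sub>C p) q = c * bessel_fischer \<alpha> p q"
  "bessel_fischer \<alpha> p (c *\<^sub>C q) = cnj c * bessel_fischer \<alpha> p q"
  by (transfer; simp add: bessel_subst_scale_left bessel_subst_scale_right sp_cnj_scale
      sp_const_linear)+

lemma sesquilinear_bessel_fischer: "sesquilinear (bessel_fischer \<alpha>)"
  by (simp add: sesquilinear_def bessel_fischer_add bessel_fischer_scale)

lemma bessel_fischer_sum:
  "bessel_fischer \<alpha> (sum f S) q = (\<Sum>i\<in>S. bessel_fischer \<alpha> (f i) q)"
  "bessel_fischer \<alpha> p (sum f S) = (\<Sum>i\<in>S. bessel_fischer \<alpha> p (f i))"
  by (induction S rule: infinite_finite_induct) (simp_all add: bessel_fischer_zero bessel_fischer_add)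

lemma fock_form_embed:
  assumes "\<alpha> \<notin> \<nat>"
  shows "fock_form \<alpha> (fock_embed \<alpha> p) (fock_embed \<alpha> q) = bessel_fischer \<alpha> p q"
proof -
  let ?P = "{i. fock_coord p i \<noteq> 0}" and ?Q = "{i. fock_coord q i \<noteq> 0}"
  let ?b = "\<lambda>i j. bessel_fischer \<alpha> (fock_basis i) (fock_basis j)"
  have w: "complex_of_real (sqrt (fock_weight \<alpha> i)) \<noteq> 0" for i
    using fock_weight_pos[OF assms, of i] by simp
  have "fock_form \<alpha> (fock_embed \<alpha> p) (fock_embed \<alpha> q) =
      (\<Sum>\<^sub>\<infinity>(i, j). fock_coord p i * cnj (fock_coord q j) * ?b i j)"
    unfolding fock_form_def ell2_nth_embed using w by simp
  also have "\<dots> = (\<Sum>\<^sub>\<infinity>(i, j)\<in>?P \<times> ?Q. fock_coord p i * cnj (fock_coord q j) * ?b i j)"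
    by (rule infsum_cong_neutral) auto
  also have "\<dots> = (\<Sum>(i, j)\<in>?P \<times> ?Q. fock_coord p i * cnj (fock_coord q j) * ?b i j)"
    by (rule infsum_finite) (intro finite_cartesian_product finite_fock_coord)
  also have "\<dots> = (\<Sum>i\<in>?P. \<Sum>j\<in>?Q. fock_coord p i * (cnj (fock_coord q j) * ?b i j))"
    by (simp add: sum.cartesian_product mult.assoc)
  also have "\<dots> = bessel_fischer \<alpha> (\<Sum>i\<in>?P. fock_coord p i *\<^sub>C fock_basis i)
      (\<Sum>j\<in>?Q. fock_coord q j *\<^sub>C fock_basis j)"
    unfolding bessel_fischer_sum bessel_fischer_scale sum_distrib_left
    by (subst sum.swap) (intro sum.cong refl mult.left_commute)
  finally show ?thesis
    by (simp only: flip: fock_poly_expand)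
qed

context
begin

private definition D :: "real \<Rightarrow> real \<Rightarrow> complex poly \<Rightarrow> complex poly" where
  "D \<alpha> t r = smult (of_real (t - \<alpha>)) (pderiv r) + pCons 0 (pderiv (pderiv r))"
private definition "S1 r = SP [:r:] 0 0 0"
private definition "S2 r = SP [:0, r:] 0 0 0"
private definition "S3 r = SP 0 [:r:] 0 0"
private definition "S4 r = SP 0 0 [:r:] 0"
private lemmas S_defs = S1_def S2_def S3_def S4_def

private lemma B1_S:
  "B1 \<alpha> (S1 r) = S1 (D \<alpha> 0 r)" "B1 \<alpha> (S2 r) = S2 (D \<alpha> 0 r)"
  "B1 \<alpha> (S3 r) = S3 (D \<alpha> 1 r)" "B1 \<alpha> (S4 r) = S4 (D \<alpha> 1 r)"
  by (rule spoly_eqI; simp add: S_defs B1_def D_def map_poly_pCons pderiv_pCons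
      algebra_simps flip: smult_add_left)+

private lemma B1_pow_S:
  "(B1 \<alpha> ^^ k) (S1 r) = S1 ((D \<alpha> 0 ^^ k) r)" "(B1 \<alpha> ^^ k) (S2 r) = S2 ((D \<alpha> 0 ^^ k) r)"
  "(B1 \<alpha> ^^ k) (S3 r) = S3 ((D \<alpha> 1 ^^ k) r)" "(B1 \<alpha> ^^ k) (S4 r) = S4 ((D \<alpha> 1 ^^ k) r)"
  by (induction k) (simp_all add: B1_S)

private lemma B234_S:
  "B2 (S1 r) = 0" "B2 (S2 r) = S1 (- r)" "B2 (S3 r) = 0" "B2 (S4 r) = 0"
  "B3 \<alpha> (S1 r) = 0" "B3 \<alpha> (S2 r) = S3 (pderiv r)" "B3 \<alpha> (S3 r) = 0"
  "B3 \<alpha> (S4 r) = S1 (smult (- 2 * of_real \<alpha>) r + pCons 0 (smult 2 (pderiv r)))"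
  "B4 \<alpha> (S1 r) = 0" "B4 \<alpha> (S2 r) = S4 (pderiv r)" "B4 \<alpha> (S4 r) = 0"
  "B4 \<alpha> (S3 r) = S1 (- (smult (- 2 * of_real \<alpha>) r + pCons 0 (smult 2 (pderiv r))))"
  by (rule spoly_eqI; simp add: S_defs B_defs map_poly_pCons pderiv_pCons)+

private lemma D_monom:
  "D \<alpha> 0 (monom c 0) = 0"
  "D \<alpha> 0 (monom c (Suc l)) = monom (c * (of_nat l + 1) * (of_nat l - of_real \<alpha>)) l"
  by (rule poly_eqI; auto simp: D_def coeff_pderiv coeff_pCons algebra_simps split: nat.split)+

private lemma D_pow_zero: "(D \<alpha> 0 ^^ k) 0 = 0"
  by (induction k) (simp_all add: D_def)

private lemma D_pow_monom:
  "coeff ((D \<alpha> 0 ^^ k) (monom c l)) 0 = of_bool (k = l) * c * fact k * pochhammer (- of_real \<alpha>) k"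
proof (induction k arbitrary: l c)
  case 0
  then show ?case by simp
next
  case (Suc k)
  show ?case
  proof (cases l)
    case 0
    then show ?thesis
      by (simp add: funpow_Suc_right D_monom D_pow_zero del: funpow.simps)
  next
    case (Suc l')
    then show ?thesis
      by (simp add: funpow_Suc_right D_monom Suc.IH pochhammer_Suc algebra_simps del: funpow.simps)
  qed
qed

private lemma const_S: "sp_const (S1 r) = coeff r 0" "sp_const (S2 r) = 0" "sp_const (S3 r) = 0"
  "sp_const (S4 r) = 0"
  by (simp_all add: sp_const_def S_defs)

private lemma basis_S:
  "z1 ^ k * gen_sp G1 = S1 (monom 1 k)" "z1 ^ k * gen_sp G2 = S2 (monom 1 k)"
  "z1 ^ k * gen_sp G3 = S3 (monom 1 k)" "z1 ^ k * gen_sp G4 = S4 (monom 1 k)"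
proof -
  have "sp0 1 = 1" "sp3 1 = 0" "sp4 1 = 0" "sp34 1 = 0" by (simp_all add: one_spoly_def)
  then show "z1 ^ k * gen_sp G1 = S1 (monom 1 k)" "z1 ^ k * gen_sp G2 = S2 (monom 1 k)"
    "z1 ^ k * gen_sp G3 = S3 (monom 1 k)" "z1 ^ k * gen_sp G4 = S4 (monom 1 k)"
    unfolding z1_pow by (simp_all add: z2_def z3_def z4_def S_defs)
qed

private lemma cnj_S: "sp_cnj (S1 (monom 1 k)) = S1 (monom 1 k)"
  "sp_cnj (S2 (monom 1 k)) = S2 (monom 1 k)" "sp_cnj (S3 (monom 1 k)) = S3 (monom 1 k)"
  "sp_cnj (S4 (monom 1 k)) = S4 (monom 1 k)"
  by (simp_all add: sp_cnj_def S_defs map_poly_pCons map_poly_monom)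

private lemma eval1_monom: "eval1 A (monom 1 k) v = (A ^^ k) v"
proof -
  have "eval1 A (monom 1 k) v = (\<Sum>a\<le>k. if a = k then (A ^^ a) v else 0)"
    unfolding eval1_bound[OF degree_monom_le] by (rule sum.cong) simp_all
  also have "\<dots> = (A ^^ k) v" by simp
  finally show ?thesis .
qed

private lemma subst_S:
  "bessel_subst \<alpha> (S1 (monom 1 k)) q = (B1 \<alpha> ^^ k) q"
  "bessel_subst \<alpha> (S2 (monom 1 k)) q = (B1 \<alpha> ^^ k) (B2 q)"
  "bessel_subst \<alpha> (S3 (monom 1 k)) q = (B1 \<alpha> ^^ k) (B3 \<alpha> q)"
  "bessel_subst \<alpha> (S4 (monom 1 k)) q = (B1 \<alpha> ^^ k) (B4 \<alpha> q)"
  by (simp_all add: bessel_subst_def S_defs eval2_def eval1_monom)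

private lemma B1_pow_zero: "(B1 \<alpha> ^^ k) 0 = 0"
  using B_scaleC(1)[of \<alpha> 0 0] by (induction k) simp_all

private lemma const_zero: "sp_const 0 = 0"
  by (simp add: sp_const_def)

private lemma monom_aux:
  "smult (- 2 * of_real \<alpha>) (monom 1 l) + pCons 0 (smult 2 (pderiv (monom 1 l)))
     = (monom (2 * (of_nat l - of_real \<alpha>)) l :: complex poly)"
  by (rule poly_eqI) (auto simp: coeff_pderiv coeff_pCons algebra_simps split: nat.split)

text \<open>The values of the Bessel--Fischer product on the basis.\<close>

lemma bessel_fischer_basis:
  "bessel_fischer \<alpha> (fock_basis (k, g)) (fock_basis (l, h)) = of_bool (k = l) * of_real
     (case (g, h) of
        (G1, G1) \<Rightarrow> fact k * pochhammer (- \<alpha>) k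
      | (G2, G2) \<Rightarrow> - (fact k * pochhammer (- \<alpha>) k)
      | (G3, G4) \<Rightarrow> 2 * fact k * pochhammer (- \<alpha>) (k + 1)
      | (G4, G3) \<Rightarrow> - (2 * fact k * pochhammer (- \<alpha>) (k + 1))
      | _ \<Rightarrow> 0)"
proof -
  have p: "of_real (pochhammer (- \<alpha>) n) = pochhammer (- complex_of_real \<alpha>) n" for n
    by (simp flip: pochhammer_of_real)
  have "sp_const (bessel_subst \<alpha> (z1 ^ k * gen_sp g) (sp_cnj (z1 ^ l * gen_sp h))) =
    of_bool (k = l) * of_real
     (case (g, h) of
        (G1, G1) \<Rightarrow> fact k * pochhammer (- \<alpha>) k
      | (G2, G2) \<Rightarrow> - (fact k * pochhammer (- \<alpha>) k)
      | (G3, G4) \<Rightarrow> 2 * fact k * pochhammer (- \<alpha>) (k + 1)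
      | (G4, G3) \<Rightarrow> - (2 * fact k * pochhammer (- \<alpha>) (k + 1))
      | _ \<Rightarrow> 0)"
    by (cases g; cases h; simp only: basis_S cnj_S subst_S B234_S monom_aux B1_pow_S const_S
        B1_pow_zero const_zero D_pow_zero minus_monom D_pow_monom fock_gen.case prod.case
        of_real_0 mult_zero_right; simp add: p pochhammer_Suc; simp add: algebra_simps)
  then show ?thesis by transfer simp
qed

end

section \<open>The Lie group\<close>

definition SL3 :: "mat2x3 set" where
  "SL3 = {(A1, A2, A3). det A1 = 1 \<and> det A2 = 1 \<and> det A3 = 1}"

fun group_mult :: "mat2x3 \<Rightarrow> mat2x3 \<Rightarrow> mat2x3" where
  "group_mult (X1, X2, X3) (Y1, Y2, Y3) = (X1 ** Y1, X2 ** Y2, X3 ** Y3)"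

definition mat_exp :: "mat2 \<Rightarrow> mat2" where
  "mat_exp X = (\<Sum>n. (1 / fact n) *\<^sub>R ((\<lambda>Y. X ** Y) ^^ n) (mat 1))"

fun group_exp :: "mat2x3 \<Rightarrow> mat2x3" where
  "group_exp (X1, X2, X3) = (mat_exp X1, mat_exp X2, mat_exp X3)"

text \<open>The action \<open>Ad\<close> on the odd part.\<close>

fun Ad_odd :: "mat2x3 \<Rightarrow> tensor \<Rightarrow> tensor" where
  "Ad_odd (A1, A2, A3) s = (\<Sum>i\<in>UNIV. \<Sum>j\<in>UNIV. \<Sum>k\<in>UNIV. s $ i $ j $ k *\<^sub>R
     tensor (A1 *v ub i) (A2 *v ub j) (A3 *v ub k))"

lemma Ad_odd_tensor:
  "Ad_odd (A1, A2, A3) (tensor x y z) = tensor (A1 *v x) (A2 *v y) (A3 *v z)"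
  by (simp add: vec_eq_iff tensor_def forall_2 sum_2 axis_def matrix_vector_mult_def algebra_simps)

text \<open>Even part \<open>[g_1, g_1]\<close> of the derived superalgebra, and the connected Lie subgroup
  belonging to it, i.e. the subgroup generated by its exponentials.\<close>

definition derived_even :: "real \<Rightarrow> mat2x3 set" where
  "derived_even \<alpha> = span (\<Union>s. range (odd_bracket \<alpha> s))"

inductive_set derived_group :: "real \<Rightarrow> mat2x3 set" for \<alpha> where
  exp: "X \<in> derived_even \<alpha> \<Longrightarrow> group_exp X \<in> derived_group \<alpha>"
| mult: "g \<in> derived_group \<alpha> \<Longrightarrow> h \<in> derived_group \<alpha> \<Longrightarrow> group_mult g h \<in> derived_group \<alpha>"


section \<open>Smooth maps\<close>

text \<open>\<open>Ck n U f\<close>: \<open>f\<close> is \<open>n\<close> times continuously differentiable on the open set \<open>U\<close> of a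
  finite-dimensional space.\<close>

primrec Ck :: "nat \<Rightarrow> 'a::real_normed_vector set \<Rightarrow> ('a \<Rightarrow> 'b::real_normed_vector) \<Rightarrow> bool" where
  "Ck 0 U f = continuous_on U f"
| "Ck (Suc n) U f = (\<exists>f'. (\<forall>x\<in>U. (f has_derivative f' x) (at x)) \<and> (\<forall>v. Ck n U (\<lambda>x. f' x v)))"

text \<open>Smooth maps on a subset, in particular on an embedded submanifold: local restrictions of
  smooth maps on open sets of the ambient space.\<close>

definition smooth_on :: "'a::real_normed_vector set \<Rightarrow> ('a \<Rightarrow> 'b::real_normed_vector) \<Rightarrow> bool" where
  "smooth_on G f \<longleftrightarrow> (\<forall>g\<in>G. \<exists>U f'. open U \<and> g \<in> U \<and> (\<forall>n. Ck n U f') \<and> (\<forall>h\<in>U \<inter> G. f' h = f h))"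


section \<open>Superunitary representations\<close>

text \<open>A superspace is given by its homogeneous parts \<open>V 0\<close> and \<open>V 1\<close>.\<close>

definition hermitian_superspace ::
  "(nat \<Rightarrow> 'h::complex_vector set) \<Rightarrow> ('h \<Rightarrow> 'h \<Rightarrow> complex) \<Rightarrow> bool" where
  "hermitian_superspace V B \<longleftrightarrow>
     csubspace (V 0) \<and> csubspace (V 1) \<and> V 0 \<inter> V 1 = {0} \<and>
     (\<forall>x. \<exists>y\<in>V 0. \<exists>z\<in>V 1. x = y + z) \<and>
     sesquilinear B \<and>
     (\<forall>a\<in>{0, 1}. \<forall>b\<in>{0, 1}. \<forall>x\<in>V a. \<forall>y\<in>V b. B x y = (- 1) ^ (a * b) * cnj (B y x)) \<and>
     (\<forall>x. (\<forall>y. B x y = 0) \<longrightarrow> x = 0)"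

text \<open>The Hilbert space topology coming from some fundamental symmetry is the topology of the
  Banach space \<open>'h\<close>.\<close>

definition hilbert_superspace ::
  "(nat \<Rightarrow> 'h::{complex_vector, banach} set) \<Rightarrow> ('h \<Rightarrow> 'h \<Rightarrow> complex) \<Rightarrow> bool" where
  "hilbert_superspace V B \<longleftrightarrow> hermitian_superspace V B \<and>
     (\<exists>J c C. fundamental_symmetry B J \<and> c > 0 \<and>
        (\<forall>x. c * (norm x)\<^sup>2 \<le> Re (B x (J x)) \<and> Re (B x (J x)) \<le> C * (norm x)\<^sup>2))"

text \<open>As superunitary operators are even, no sign occurs in the definition of the adjoint \<open>S\<close>.\<close>

definition superunitary_op ::
  "(nat \<Rightarrow> 'h::{complex_vector, banach} set) \<Rightarrow> ('h \<Rightarrow> 'h \<Rightarrow> complex) \<Rightarrow> ('h \<Rightarrow> 'h) \<Rightarrow> bool" where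
  "superunitary_op V B T \<longleftrightarrow> clinear T \<and> bounded_linear T \<and> (\<forall>a\<in>{0, 1}. T ` V a \<subseteq> V a) \<and>
     (\<exists>S. clinear S \<and> bounded_linear S \<and> (\<forall>x y. B (S x) y = B x (T y)) \<and>
        S \<circ> T = id \<and> T \<circ> S = id)"

definition smooth_vectors :: "mat2x3 set \<Rightarrow> (mat2x3 \<Rightarrow> 'h \<Rightarrow> 'h::{complex_vector, banach}) \<Rightarrow> 'h set" where
  "smooth_vectors G \<pi>0 = {v. smooth_on G (\<lambda>g. \<pi>0 g v)}"

definition lie_part :: "mat2x3 set \<Rightarrow> nat \<Rightarrow> lie set" where
  "lie_part g0 a = (if a = 0 then g0 \<times> {0} else {0} \<times> UNIV)"

text \<open>Superunitary representations of the sub-supergroup of \<open>D(2,1;\<alpha>)\<close> with Lie group \<open>G\<close> and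
  Lie superalgebra \<open>g0 \<oplus> g_1\<close>, \<open>g_1\<close> being the whole odd part.\<close>

definition superunitary_rep ::
  "real \<Rightarrow> mat2x3 set \<Rightarrow> mat2x3 set \<Rightarrow> (nat \<Rightarrow> 'h::{complex_vector, banach} set) \<Rightarrow>
     ('h \<Rightarrow> 'h \<Rightarrow> complex) \<Rightarrow> (mat2x3 \<Rightarrow> 'h \<Rightarrow> 'h) \<Rightarrow> (lie \<Rightarrow> 'h \<Rightarrow> 'h) \<Rightarrow> bool" where
  "superunitary_rep \<alpha> G g0 V B \<pi>0 d\<pi> \<longleftrightarrow>
     hilbert_superspace V B \<and>
     (\<forall>g\<in>G. superunitary_op V B (\<pi>0 g)) \<and>
     (\<forall>g\<in>G. \<forall>h\<in>G. \<pi>0 (group_mult g h) = \<pi>0 g \<circ> \<pi>0 h) \<and>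
     (\<forall>v. continuous_on G (\<lambda>g. \<pi>0 g v)) \<and>
     (let W = smooth_vectors G \<pi>0; g = g0 \<times> UNIV in
        (\<forall>X\<in>g. d\<pi> X ` W \<subseteq> W \<and>
           (\<forall>v\<in>W. \<forall>w\<in>W. d\<pi> X (v + w) = d\<pi> X v + d\<pi> X w) \<and>
           (\<forall>c. \<forall>v\<in>W. d\<pi> X (c *\<^sub>C v) = c *\<^sub>C d\<pi> X v)) \<and>
        (\<forall>X\<in>g. \<forall>Y\<in>g. \<forall>v\<in>W. d\<pi> (X + Y) v = d\<pi> X v + d\<pi> Y v) \<and>
        (\<forall>X\<in>g. \<forall>r. \<forall>v\<in>W. d\<pi> (r *\<^sub>R X) v = r *\<^sub>R d\<pi> X v) \<and>
        (\<forall>a\<in>{0, 1}. \<forall>b\<in>{0, 1}. \<forall>X\<in>lie_part g0 a. d\<pi> X ` (W \<inter> V b) \<subseteq> V ((a + b) mod 2)) \<and>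
        (\<forall>a\<in>{0, 1}. \<forall>b\<in>{0, 1}. \<forall>X\<in>lie_part g0 a. \<forall>Y\<in>lie_part g0 b. \<forall>v\<in>W.
           d\<pi> (lie_bracket \<alpha> X Y) v = d\<pi> X (d\<pi> Y v) - (- 1) ^ (a * b) *\<^sub>R d\<pi> Y (d\<pi> X v)) \<and>
        (\<forall>X\<in>g0. \<forall>v\<in>W.
           ((\<lambda>t. \<pi>0 (group_exp (t *\<^sub>R X)) v) has_vector_derivative d\<pi> (X, 0) v) (at 0)) \<and>
        (\<forall>a\<in>{0, 1}. \<forall>b\<in>{0, 1}. \<forall>X\<in>lie_part g0 a. \<forall>v\<in>W \<inter> V b. \<forall>w\<in>W.
           B (d\<pi> X v) w = - ((- 1) ^ (a * b) * B v (d\<pi> X w))) \<and>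
        (\<forall>A\<in>G. \<forall>s. \<forall>v\<in>W. \<pi>0 A (d\<pi> (0, s) (inv (\<pi>0 A) v)) = d\<pi> (0, Ad_odd A s) v))"

text \<open>Unitarizability with \<open>J\<close> of a group action, given by the set \<open>\<T>\<close> of the operators by
  which the group acts.\<close>

definition unitarizable ::
  "('h::complex_vector \<Rightarrow> 'h \<Rightarrow> complex) \<Rightarrow> ('h \<Rightarrow> 'h) set \<Rightarrow> ('h \<Rightarrow> 'h) \<Rightarrow> bool" where
  "unitarizable B \<T> J \<longleftrightarrow> fundamental_symmetry B J \<and>
     (\<forall>T\<in>\<T>. unitary_wrt (\<lambda>x y. B x (J y)) T)"

text \<open>Restricting to the derived sub-supergroup may enlarge the space of smooth vectors; to admit
  a restriction means that \<open>d\<pi>\<close> extends to these.\<close>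

definition admits_restriction ::
  "real \<Rightarrow> (nat \<Rightarrow> 'h::{complex_vector, banach} set) \<Rightarrow>
     ('h \<Rightarrow> 'h \<Rightarrow> complex) \<Rightarrow> (mat2x3 \<Rightarrow> 'h \<Rightarrow> 'h) \<Rightarrow> (lie \<Rightarrow> 'h \<Rightarrow> 'h) \<Rightarrow> bool" where
  "admits_restriction \<alpha> V B \<pi>0 d\<pi> \<longleftrightarrow>
     (\<exists>d\<pi>'. superunitary_rep \<alpha> (derived_group \<alpha>) (derived_even \<alpha>) V B \<pi>0 d\<pi>' \<and>
        (\<forall>X\<in>derived_even \<alpha> \<times> UNIV. \<forall>v\<in>smooth_vectors SL3 \<pi>0. d\<pi>' X v = d\<pi> X v))"

definition strong_superunitary_rep ::
  "real \<Rightarrow> (nat \<Rightarrow> 'h::{complex_vector, banach} set) \<Rightarrow>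
     ('h \<Rightarrow> 'h \<Rightarrow> complex) \<Rightarrow> (mat2x3 \<Rightarrow> 'h \<Rightarrow> 'h) \<Rightarrow> (lie \<Rightarrow> 'h \<Rightarrow> 'h) \<Rightarrow> bool" where
  "strong_superunitary_rep \<alpha> V B \<pi>0 d\<pi> \<longleftrightarrow> superunitary_rep \<alpha> SL3 sl3 V B \<pi>0 d\<pi> \<and>
     (\<exists>J. unitarizable B (\<pi>0 ` SL3) J) \<and> admits_restriction \<alpha> V B \<pi>0 d\<pi>"


section \<open>The group action on the Fock space\<close>

text \<open>\<open>exp_drho \<alpha> X T\<close> means \<open>T = exp (d\<rho>(X))\<close>.  As \<open>d\<rho>(X)\<close> is unbounded, its exponential is the
  value at time 1 of the strongly continuous one-parameter group generated by \<open>d\<rho>(X)\<close>, the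
  polynomials being analytic vectors and hence a core.\<close>

definition exp_drho :: "real \<Rightarrow> mat2x3 \<Rightarrow> (fock \<Rightarrow> fock) \<Rightarrow> bool" where
  "exp_drho \<alpha> X T \<longleftrightarrow> (\<exists>U :: real \<Rightarrow> fock \<Rightarrow> fock.
     (\<forall>t. clinear (U t) \<and> bounded_linear (U t)) \<and>
     U 0 = id \<and> (\<forall>s t. U (s + t) = U s \<circ> U t) \<and> (\<forall>x. continuous_on UNIV (\<lambda>t. U t x)) \<and>
     (\<forall>p. ((\<lambda>t. U t (fock_embed \<alpha> p)) has_vector_derivative
        fock_embed \<alpha> (drho \<alpha> (X, 0) p)) (at 0)) \<and>
     T = U 1)"

text \<open>The operators \<open>\<rho>_0(exp X) = exp (d\<rho>(X))\<close> for \<open>X\<close> in the even part of the Lie superalgebra.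
  Since \<open>exp (2\<pi>(E_2 - F_2)) = 1\<close> and \<open>exp (2\<pi> d\<rho>(E_2 - F_2))\<close> is the scalar \<open>exp (- 2\<pi>\<i>\<alpha>)\<close>,
  this prescription is single-valued on the group only for integral \<open>\<alpha>\<close> (in general it is an
  action of a covering group); hence it is kept as a set of operators.\<close>

definition rho0_ops :: "real \<Rightarrow> (fock \<Rightarrow> fock) set" where
  "rho0_ops \<alpha> = {T. \<exists>X\<in>sl3. exp_drho \<alpha> X T}"

text \<open>Unitarizability with a fundamental symmetry \<open>J\<close> of the polynomial Fock space: the operators
  are unitary for an inner product on the Fock space extending \<open>(\<cdot>,\<cdot>)_J\<close>.\<close>

definition rho0_unitarizable_poly :: "real \<Rightarrow> (fock_poly \<Rightarrow> fock_poly) \<Rightarrow> bool" where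
  "rho0_unitarizable_poly \<alpha> J \<longleftrightarrow> (\<exists>ip. inner_product ip \<and>
     (\<forall>p q. ip (fock_embed \<alpha> p) (fock_embed \<alpha> q) = bessel_fischer \<alpha> p (J q)) \<and>
     (\<forall>T\<in>rho0_ops \<alpha>. unitary_wrt ip T))"

definition is_rho0 :: "real \<Rightarrow> (mat2x3 \<Rightarrow> fock \<Rightarrow> fock) \<Rightarrow> bool" where
  "is_rho0 \<alpha> \<pi>0 \<longleftrightarrow> (\<forall>X\<in>sl3. exp_drho \<alpha> X (\<pi>0 (group_exp X)))"

definition extends_drho :: "real \<Rightarrow> (lie \<Rightarrow> fock \<Rightarrow> fock) \<Rightarrow> bool" where
  "extends_drho \<alpha> d\<pi> \<longleftrightarrow>
     (\<forall>X\<in>sl3 \<times> UNIV. \<forall>p. d\<pi> X (fock_embed \<alpha> p) = fock_embed \<alpha> (drho \<alpha> X p))"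

section \<open>The Fock space is a Hilbert superspace\<close>

lemma ell2_prod_summable: "(\<lambda>i. ell2_nth x i * cnj (ell2_nth y i)) summable_on UNIV"
proof -
  have "(\<lambda>i. norm (ell2_nth x i * cnj (ell2_nth y i))) summable_on UNIV"
  proof (rule summable_on_comparison_test)
    show "(\<lambda>i. (cmod (ell2_nth x i))\<^sup>2 + (cmod (ell2_nth y i))\<^sup>2) summable_on UNIV"
      by (intro summable_on_add ell2_summable)
    show "norm (ell2_nth x i * cnj (ell2_nth y i))
        \<le> (cmod (ell2_nth x i))\<^sup>2 + (cmod (ell2_nth y i))\<^sup>2" for i
      using sum_squares_bound[of "cmod (ell2_nth x i)" "cmod (ell2_nth y i)"]
        mult_nonneg_nonneg[OF norm_ge_zero[of "ell2_nth x i"] norm_ge_zero[of "ell2_nth y i"]]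
      unfolding norm_mult complex_mod_cnj by linarith
  qed simp
  then show ?thesis by (rule abs_summable_summable)
qed

definition ell2_cinner :: "'i ell2 \<Rightarrow> 'i ell2 \<Rightarrow> complex" where
  "ell2_cinner x y = (\<Sum>\<^sub>\<infinity>i. ell2_nth x i * cnj (ell2_nth y i))"

lemma ell2_cinner_add:
  "ell2_cinner (x + y) z = ell2_cinner x z + ell2_cinner y z"
  "ell2_cinner x (y + z) = ell2_cinner x y + ell2_cinner x z"
  unfolding ell2_cinner_def
  by (simp_all only: ell2_nth_simps complex_cnj_add distrib_left distrib_right
      infsum_add[OF ell2_prod_summable ell2_prod_summable])

lemma ell2_cinner_scale:
  "ell2_cinner (c *\<^sub>C x) z = c * ell2_cinner x z"
  "ell2_cinner x (c *\<^sub>C z) = cnj c * ell2_cinner x z"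
  unfolding ell2_cinner_def
  by (simp_all only: ell2_nth_simps complex_cnj_mult mult.assoc mult.left_commute[of _ "cnj c"]
      infsum_cmult_right[OF ell2_prod_summable])

lemma ell2_cinner_commute: "ell2_cinner x y = cnj (ell2_cinner y x)"
  unfolding ell2_cinner_def by (simp add: mult.commute flip: infsum_cnj)

lemma ell2_cinner_self: "ell2_cinner x x = of_real ((norm x)\<^sup>2)"
proof -
  have "ell2_nth x i * cnj (ell2_nth x i) = of_real ((cmod (ell2_nth x i))\<^sup>2)" for i
    by (simp only: complex_norm_square)
  moreover have "(\<Sum>\<^sub>\<infinity>i. complex_of_real ((cmod (ell2_nth x i))\<^sup>2)) =
      of_real (\<Sum>\<^sub>\<infinity>i. (cmod (ell2_nth x i))\<^sup>2)"
    by (intro infsumI has_sum_of_real has_sum_infsum ell2_summable)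
  ultimately show ?thesis
    unfolding ell2_cinner_def ell2_norm_sq by (simp only:)
qed

fun partner :: "fock_idx \<Rightarrow> fock_idx" where
  "partner (k, G1) = (k, G1)" | "partner (k, G2) = (k, G2)"
| "partner (k, G3) = (k, G4)" | "partner (k, G4) = (k, G3)"

fun form_sign :: "real \<Rightarrow> fock_idx \<Rightarrow> real" where
  "form_sign \<alpha> (k, G1) = sgn (pochhammer (- \<alpha>) k)"
| "form_sign \<alpha> (k, G2) = - sgn (pochhammer (- \<alpha>) k)"
| "form_sign \<alpha> (k, G3) = sgn (pochhammer (- \<alpha>) (k + 1))"
| "form_sign \<alpha> (k, G4) = - sgn (pochhammer (- \<alpha>) (k + 1))"

lemma partner_partner [simp]: "partner (partner i) = i"
  by (cases i rule: partner.cases) simp_all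

lemma bij_partner: "bij partner"
  by (rule o_bij[of partner]) (auto simp: fun_eq_iff)

lemma fock_weight_partner: "fock_weight \<alpha> (partner i) = fock_weight \<alpha> i"
  by (cases i rule: partner.cases) simp_all

lemma form_sign_cases:
  assumes "\<alpha> \<notin> \<nat>"
  shows "form_sign \<alpha> i = 1 \<or> form_sign \<alpha> i = - 1"
proof -
  have "pochhammer (- \<alpha>) k \<noteq> 0" for k
    using assms by (auto simp: pochhammer_eq_0_iff)
  then have "sgn (pochhammer (- \<alpha>) k) = 1 \<or> sgn (pochhammer (- \<alpha>) k) = - 1" for k
    by (metis sgn_real_def)
  then show ?thesis
    by (cases i rule: partner.cases; simp only: form_sign.simps) (metis minus_minus)+
qed

lemma bessel_fischer_basis_sign:
  "bessel_fischer \<alpha> (fock_basis i) (fock_basis j) =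
     of_bool (j = partner i) * of_real (form_sign \<alpha> i * fock_weight \<alpha> i)"
proof -
  have s: "sgn (x::real) * \<bar>x\<bar> = x" for x by (simp add: mult.commute abs_mult_sgn)
  have s': "sgn (x::real) * (c * \<bar>x\<bar>) = c * x" for x c
    using s[of x] by (metis mult.left_commute)
  obtain k g l h where ij: "i = (k, g)" "j = (l, h)" by (metis surj_pair)
  show ?thesis
    unfolding ij bessel_fischer_basis
    by (cases g; cases h; simp only: partner.simps form_sign.simps fock_weight.simps prod.case
        fock_gen.case prod.inject fock_gen.distinct mult_minus_left s' simp_thms of_bool_eq
        of_real_0 mult_zero_right mult_zero_left eq_commute[of k l])
qed

lift_definition fock_twist :: "(fock_idx \<Rightarrow> complex) \<Rightarrow> fock \<Rightarrow> fock" is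
  "\<lambda>s f i. (if cmod (s i) = 1 then s i else 0) * f (partner i)"
proof -
  fix s f :: "fock_idx \<Rightarrow> complex"
  assume "(\<lambda>i. (cmod (f i))\<^sup>2) summable_on UNIV"
  then have "(\<lambda>i. (cmod (f (partner i)))\<^sup>2) summable_on UNIV"
    using summable_on_reindex_bij_betw[OF bij_partner, of "\<lambda>i. (cmod (f i))\<^sup>2"] by simp
  then show "(\<lambda>i. (cmod ((if cmod (s i) = 1 then s i else 0) * f (partner i)))\<^sup>2) summable_on UNIV"
    by (rule summable_on_comparison_test) (auto simp: norm_mult)
qed

definition fock_K :: "real \<Rightarrow> fock \<Rightarrow> fock" where
  "fock_K \<alpha> = fock_twist (\<lambda>i. of_real (form_sign \<alpha> i))"

definition fock_J :: "real \<Rightarrow> fock \<Rightarrow> fock" where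
  "fock_J \<alpha> = fock_twist (\<lambda>i. of_real (form_sign \<alpha> (partner i)))"

context
  fixes \<alpha> :: real
  assumes \<alpha>: "\<alpha> \<notin> \<nat>"
begin

lemma form_sign_sq: "complex_of_real (form_sign \<alpha> i) * (complex_of_real (form_sign \<alpha> i) * z) = z"
  using form_sign_cases[OF \<alpha>, of i] by auto

lemma norm_form_sign: "cmod (of_real (form_sign \<alpha> i)) = 1"
  using form_sign_cases[OF \<alpha>, of i] by auto

lemma nth_K: "ell2_nth (fock_K \<alpha> x) i = of_real (form_sign \<alpha> i) * ell2_nth x (partner i)"
  by (simp only: fock_K_def fock_twist.rep_eq norm_form_sign if_True refl)

lemma nth_J: "ell2_nth (fock_J \<alpha> x) i = of_real (form_sign \<alpha> (partner i)) * ell2_nth x (partner i)"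
  by (simp only: fock_J_def fock_twist.rep_eq norm_form_sign if_True refl)

lemma K_J: "fock_K \<alpha> (fock_J \<alpha> x) = x" "fock_J \<alpha> (fock_K \<alpha> x) = x"
  by (rule ell2_eqI; simp only: nth_K nth_J partner_partner form_sign_sq)+

lemma clinear_K: "clinear (fock_K \<alpha>)" and clinear_J: "clinear (fock_J \<alpha>)"
  unfolding clinear_def
  by (auto intro!: ell2_eqI simp: nth_K nth_J algebra_simps)

lemma fock_form_cinner: "fock_form \<alpha> x y = ell2_cinner x (fock_K \<alpha> y)"
proof -
  let ?w = "\<lambda>i. complex_of_real (sqrt (fock_weight \<alpha> i))"
  let ?t = "\<lambda>(i, j). ell2_nth x i / ?w i * cnj (ell2_nth y j / ?w j) *
     bessel_fischer \<alpha> (fock_basis i) (fock_basis j)"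
  let ?g = "\<lambda>i. (i, partner i)"
  have w: "?w i \<noteq> 0" "complex_of_real (fock_weight \<alpha> i) = ?w i * ?w i" for i
    using fock_weight_pos[OF \<alpha>, of i] by (simp_all flip: of_real_mult)
  have "fock_form \<alpha> x y = infsum ?t (range ?g)"
    unfolding fock_form_def
    by (rule infsum_cong_neutral) (auto simp: bessel_fischer_basis_sign)
  also have "\<dots> = infsum (?t \<circ> ?g) UNIV"
    by (rule infsum_reindex) (auto intro: inj_onI)
  also have "\<dots> = ell2_cinner x (fock_K \<alpha> y)"
    unfolding ell2_cinner_def
  proof (rule infsum_cong)
    fix i
    have "(?t \<circ> ?g) i = ell2_nth x i / ?w i * (cnj (ell2_nth y (partner i)) / ?w i) *
        (of_real (form_sign \<alpha> i) * (?w i * ?w i))"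
      by (simp add: bessel_fischer_basis_sign fock_weight_partner w(2))
    also have "\<dots> = ell2_nth x i * (of_real (form_sign \<alpha> i) * cnj (ell2_nth y (partner i)))"
      using w(1)[of i] by (simp add: field_simps)
    finally show "(?t \<circ> ?g) i = ell2_nth x i * cnj (ell2_nth (fock_K \<alpha> y) i)"
      by (simp only: nth_K complex_cnj_mult complex_cnj_complex_of_real)
  qed
  finally show ?thesis .
qed

lemma cinner_J: "ell2_cinner (fock_J \<alpha> x) y = ell2_cinner x (fock_K \<alpha> y)"
proof -
  have "ell2_cinner x (fock_K \<alpha> y) =
      (\<Sum>\<^sub>\<infinity>i. of_real (form_sign \<alpha> i) * ell2_nth x i * cnj (ell2_nth y (partner i)))"
    unfolding ell2_cinner_def by (rule infsum_cong) (simp add: nth_K)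
  also have "\<dots> = (\<Sum>\<^sub>\<infinity>i. of_real (form_sign \<alpha> (partner i)) * ell2_nth x (partner i) *
      cnj (ell2_nth y (partner (partner i))))"
    by (rule infsum_reindex_bij_betw[OF bij_partner, symmetric])
  finally show ?thesis
    by (simp only: ell2_cinner_def nth_J partner_partner)
qed

lemma fundamental_symmetry_fock_J: "fundamental_symmetry (fock_form \<alpha>) (fock_J \<alpha>)"
proof -
  have JJ: "fock_J \<alpha> (fock_J \<alpha> (fock_J \<alpha> (fock_J \<alpha> x))) = x" for x
  proof (rule ell2_eqI)
    fix i
    show "ell2_nth (fock_J \<alpha> (fock_J \<alpha> (fock_J \<alpha> (fock_J \<alpha> x)))) i = ell2_nth x i"
      using form_sign_cases[OF \<alpha>, of i] form_sign_cases[OF \<alpha>, of "partner i"]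
      by (auto simp: nth_J)
  qed
  have "fock_form \<alpha> (fock_J \<alpha> x) (fock_J \<alpha> y) = fock_form \<alpha> x y" for x y
    by (simp only: fock_form_cinner K_J cinner_J)
  moreover have "inner_product (\<lambda>x y. fock_form \<alpha> x (fock_J \<alpha> y))"
    unfolding inner_product_def sesquilinear_def fock_form_cinner K_J
    using ell2_cinner_commute
    by (auto simp: ell2_cinner_add ell2_cinner_scale ell2_cinner_self)
  ultimately show ?thesis
    by (simp add: fundamental_symmetry_def clinear_J eval_nat_numeral JJ)
qed

lemma hilbert_superspace_fock: "hilbert_superspace fock_grade (fock_form \<alpha>)"
proof -
  have herm: "fock_form \<alpha> x y = (- 1) ^ (a * b) * cnj (fock_form \<alpha> y x)"
    if "a \<in> {0, 1}" "b \<in> {0, 1}" "x \<in> fock_grade a" "y \<in> fock_grade b" for a b x y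
  proof -
    have "cnj (fock_form \<alpha> y x) = ell2_cinner x (fock_J \<alpha> y)"
      by (metis fock_form_cinner ell2_cinner_commute cinner_J)
    moreover have "ell2_nth x i * cnj (ell2_nth (fock_K \<alpha> y) i) =
        (- 1) ^ (a * b) * (ell2_nth x i * cnj (ell2_nth (fock_J \<alpha> y) i))" for i
      using that by (cases i rule: partner.cases) (auto simp: fock_grade_def nth_K nth_J)
    then have "ell2_cinner x (fock_K \<alpha> y) = (- 1) ^ (a * b) * ell2_cinner x (fock_J \<alpha> y)"
      unfolding ell2_cinner_def
      by (simp only: infsum_cmult_right[OF ell2_prod_summable])
    ultimately show ?thesis by (simp only: fock_form_cinner)
  qed
  have dec: "\<exists>y\<in>fock_grade 0. \<exists>z\<in>fock_grade 1. x = y + z" for x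
  proof -
    let ?e = "\<lambda>i. snd i = G1 \<or> snd i = G2"
    have sm: "(\<lambda>i. (cmod (if P i then ell2_nth x i else 0))\<^sup>2) summable_on UNIV" for P
      by (rule summable_on_comparison_test[OF ell2_summable[of x]]) auto
    define y where "y = Abs_ell2 (\<lambda>i. if ?e i then ell2_nth x i else 0)"
    define z where "z = Abs_ell2 (\<lambda>i. if \<not> ?e i then ell2_nth x i else 0)"
    have y: "ell2_nth y i = (if ?e i then ell2_nth x i else 0)"
      and z: "ell2_nth z i = (if \<not> ?e i then ell2_nth x i else 0)" for i
      using sm[of ?e] sm[of "\<lambda>i. \<not> ?e i"] by (simp_all add: y_def z_def Abs_ell2_inverse)
    have "x = y + z" by (rule ell2_eqI) (simp add: y z)
    moreover have "y \<in> fock_grade 0" "z \<in> fock_grade 1"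
      by (simp_all add: fock_grade_def y z)
    ultimately show ?thesis by blast
  qed
  have int: "fock_grade 0 \<inter> fock_grade 1 = {0}"
  proof (intro equalityI subsetI)
    fix x assume x: "x \<in> fock_grade 0 \<inter> fock_grade 1"
    have "ell2_nth x i = 0" for i
      using x by (cases i rule: partner.cases) (simp_all add: fock_grade_def)
    then have "x = 0" by (intro ell2_eqI) simp
    then show "x \<in> {0}" by simp
  qed (simp add: fock_grade_def)
  have nd: "x = 0" if "\<forall>y. fock_form \<alpha> x y = 0" for x
    using that[rule_format, of "fock_J \<alpha> x"] by (simp add: fock_form_cinner K_J ell2_cinner_self)
  have sq: "sesquilinear (fock_form \<alpha>)"
    using clinear_K unfolding sesquilinear_def clinear_def fock_form_cinner
    by (simp add: ell2_cinner_add ell2_cinner_scale)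
  have cs: "csubspace (fock_grade a)" for a
    unfolding csubspace_def fock_grade_def by (cases "a = 0") simp_all
  have "hermitian_superspace fock_grade (fock_form \<alpha>)"
    unfolding hermitian_superspace_def
  proof (intro conjI)
    show "\<forall>x. \<exists>y\<in>fock_grade 0. \<exists>z\<in>fock_grade 1. x = y + z"
      by (intro allI dec)
    show "\<forall>a\<in>{0, 1}. \<forall>b\<in>{0, 1}. \<forall>x\<in>fock_grade a. \<forall>y\<in>fock_grade b.
        fock_form \<alpha> x y = (- 1) ^ (a * b) * cnj (fock_form \<alpha> y x)"
      by (intro ballI herm)
    show "\<forall>x. (\<forall>y. fock_form \<alpha> x y = 0) \<longrightarrow> x = 0"
      using nd by blast
  qed (rule cs int sq)+
  moreover have "Re (fock_form \<alpha> x (fock_J \<alpha> x)) = (norm x)\<^sup>2" for x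
    by (simp add: fock_form_cinner K_J ell2_cinner_self)
  ultimately show ?thesis
    unfolding hilbert_superspace_def
    by (intro conjI exI[of _ "fock_J \<alpha>"] exI[of _ "1::real"] fundamental_symmetry_fock_J) simp_all
qed

end

end

theory Submission
  imports Defs
begin

text \<open>
  The element \<open>H_3\<close> acts on \<open>F\<close> by interchanging \<open>z1^k\<close> with \<open>z1^k z2\<close> and by annihilating
  \<open>z1^k z3\<close> and \<open>z1^k z4\<close>.  This is a bounded operator, so its exponential exists, and
  \<open>1 + z2\<close> is an eigenvector with eigenvalue 1.  Hence \<open>\<rho>_0(exp H_3)\<close> stretches
  \<open>1 + z2\<close> by the factor \<open>e\<close>, which a unitary operator cannot do.
\<close>

text \<open>Unitarity gives \<open>ip v v\<close> = c^2 \<open>ip v v\<close>, so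
  \<open>ip v v\<close> vanishes and positivity leaves only \<open>v = 0\<close>.\<close>

lemma unitary_wrt_eigenvector:
  assumes "inner_product ip" "unitary_wrt ip T" "T v = c *\<^sub>R v" "c\<^sup>2 \<noteq> 1"
  shows "v = 0"
proof -
  have "ip (a *\<^sub>C x) y = a * ip x y" "ip x (a *\<^sub>C y) = cnj a * ip x y" for a x y
    using assms(1) unfolding inner_product_def sesquilinear_def by blast+
  then have "ip (c *\<^sub>R v) (c *\<^sub>R v) = of_real (c\<^sup>2) * ip v v"
    by (simp add: power2_eq_square flip: scaleC_of_real)
  moreover have "ip (c *\<^sub>R v) (c *\<^sub>R v) = ip v v"
    using assms(2,3) by (metis unitary_wrt_def)
  ultimately have "(of_real (c\<^sup>2) - 1) * ip v v = 0"
    by (simp add: algebra_simps)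
  moreover have "complex_of_real (c\<^sup>2) - 1 \<noteq> 0"
    using assms(4) by (metis eq_iff_diff_eq_0 of_real_eq_1_iff)
  ultimately have "Re (ip v v) = 0" by simp
  moreover have "v \<noteq> 0 \<longrightarrow> Re (ip v v) > 0"
    using assms(1) unfolding inner_product_def by blast
  ultimately show ?thesis by auto
qed

text \<open>The orbit of an eigenvector solves u' = r u, which determines it uniquely. The
  conclusion therefore holds for every \<open>T\<close> that qualifies as an exponential, whichever
  group \<open>U\<close> witnesses it.\<close>

lemma exp_drho_eigenvector:
  assumes T: "exp_drho \<alpha> X T" and p: "drho \<alpha> (X, 0) p = r *\<^sub>R p"
  shows "T (fock_embed \<alpha> p) = exp r *\<^sub>R fock_embed \<alpha> p"
proof -
  let ?v = "fock_embed \<alpha> p"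
  obtain U where U: "\<And>t. bounded_linear (U t)" "U 0 = id" "\<And>s t. U (s + t) = U s \<circ> U t"
    and der: "((\<lambda>t. U t ?v) has_vector_derivative fock_embed \<alpha> (drho \<alpha> (X, 0) p)) (at 0)"
    and T1: "T = U 1"
    using T unfolding exp_drho_def by blast
  have "fock_embed \<alpha> (r *\<^sub>R p) = r *\<^sub>R ?v"
    by (rule ell2_eqI) (simp add: ell2_nth_embed flip: scaleC_of_real)
  then have der0: "((\<lambda>t. U t ?v) has_vector_derivative r *\<^sub>R ?v) (at 0)"
    using der by (simp add: p)
  have derU: "((\<lambda>t. U t ?v) has_vector_derivative r *\<^sub>R U t ?v) (at t)" for t
  proof -
    interpret bounded_linear "U t" by (rule U(1))
    \<comment> \<open>The derivative is given at 0 only; the group law carries it to time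
      \<open>t\<close>, and the bounded operator \<open>U t\<close> commutes with
      differentiation.\<close>
    have "((\<lambda>s. U t (U (s - t) ?v)) has_vector_derivative U t (r *\<^sub>R ?v)) (at t)"
    proof (rule has_vector_derivative)
      have "((\<lambda>s. U s ?v) \<circ> (\<lambda>s. s - t) has_vector_derivative 1 *\<^sub>R r *\<^sub>R ?v) (at t)"
        by (rule vector_diff_chain_at)
          (auto intro!: derivative_eq_intros simp: der0)
      then show "((\<lambda>s. U (s - t) ?v) has_vector_derivative r *\<^sub>R ?v) (at t)"
        by (simp add: o_def)
    qed
    moreover have "U t (U (s - t) ?v) = U s ?v" for s
      using U(3)[of t "s - t"] by simp
    ultimately show ?thesis by (simp add: scaleR)
  qed
  \<comment> \<open>Integrating factor for u' = r u.\<close>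
  have "((\<lambda>t. exp (- r * t) *\<^sub>R U t ?v) has_vector_derivative 0) (at t within UNIV)" for t
  proof -
    have e: "((\<lambda>t. exp (- r * t)) has_field_derivative - r * exp (- r * t)) (at t)"
      by (auto intro!: derivative_eq_intros)
    show ?thesis
      using has_vector_derivative_scaleR[OF e derU] by (simp add: mult.commute)
  qed
  then obtain k where k: "exp (- r * t) *\<^sub>R U t ?v = k" for t
    using has_vector_derivative_zero_constant[of UNIV "\<lambda>t. exp (- r * t) *\<^sub>R U t ?v"]
    by auto
  have "?v = k" using k[of 0] by (simp add: U(2))
  then have "exp r *\<^sub>R exp (- r) *\<^sub>R U 1 ?v = exp r *\<^sub>R ?v"
    using k[of 1] by simp
  then show ?thesis by (simp add: T1 flip: exp_add)
qed

text \<open>The odd indices are fixed so that this is a bijection of all indices, as the reindexing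
  of sums requires; \<open>fock_H3\<close> sets the odd coordinates to 0 separately.\<close>

fun swap12 :: "fock_idx \<Rightarrow> fock_idx" where
  "swap12 (k, G1) = (k, G2)" | "swap12 (k, G2) = (k, G1)"
| "swap12 (k, G3) = (k, G3)" | "swap12 (k, G4) = (k, G4)"

lemma bij_swap12: "bij swap12"
proof (rule o_bij[of swap12])
  have "swap12 (swap12 i) = i" for i by (cases i rule: swap12.cases) simp_all
  then show "swap12 \<circ> swap12 = id" "swap12 \<circ> swap12 = id" by auto
qed

text \<open>This is the continuous extension of the action of H_3 from polynomials to the
  completion.\<close>

lift_definition fock_H3 :: "fock \<Rightarrow> fock" is
  "\<lambda>f i. if snd i \<in> {G1, G2} then f (swap12 i) else 0"
proof -
  fix f :: "fock_idx \<Rightarrow> complex"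
  assume "(\<lambda>i. (cmod (f i))\<^sup>2) summable_on UNIV"
  then have "(\<lambda>i. (cmod (f (swap12 i)))\<^sup>2) summable_on UNIV"
    using summable_on_reindex_bij_betw[OF bij_swap12, of "\<lambda>i. (cmod (f i))\<^sup>2"] by simp
  then show "(\<lambda>i. (cmod (if snd i \<in> {G1, G2} then f (swap12 i) else 0))\<^sup>2) summable_on UNIV"
    by (rule summable_on_comparison_test) auto
qed

lemma nth_H3:
  "ell2_nth (fock_H3 x) i = (if snd i \<in> {G1, G2} then ell2_nth x (swap12 i) else 0)"
  by (simp add: fock_H3.rep_eq)

lemma H3_linear:
  "fock_H3 (x + y) = fock_H3 x + fock_H3 y" "fock_H3 (x - y) = fock_H3 x - fock_H3 y"
  "fock_H3 (c *\<^sub>C x) = c *\<^sub>C fock_H3 x" "fock_H3 (r *\<^sub>R x) = r *\<^sub>R fock_H3 x"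
  by (rule ell2_eqI; simp add: nth_H3)+

text \<open>The square is the projection onto the even part, not the identity, since odd vectors are
  killed.\<close>

lemma H3_cubed: "fock_H3 (fock_H3 (fock_H3 x)) = fock_H3 x"
proof (rule ell2_eqI)
  fix i show "ell2_nth (fock_H3 (fock_H3 (fock_H3 x))) i = ell2_nth (fock_H3 x) i"
    by (cases i rule: swap12.cases) (simp_all add: nth_H3)
qed

text \<open>A permutation of coordinates followed by a coordinate projection is a
  contraction.\<close>

lemma bounded_linear_H3: "bounded_linear fock_H3"
proof (rule bounded_linear_intro[where K = 1])
  fix x
  have "(norm (fock_H3 x))\<^sup>2 \<le> (\<Sum>\<^sub>\<infinity>i. (cmod (ell2_nth x (swap12 i)))\<^sup>2)"
    unfolding ell2_norm_sq
    using summable_on_reindex_bij_betw[OF bij_swap12, of "\<lambda>i. (cmod (ell2_nth x i))\<^sup>2"]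
    by (intro infsum_mono ell2_summable) (auto simp: nth_H3 ell2_summable)
  also have "\<dots> = (norm x)\<^sup>2"
    using infsum_reindex_bij_betw[OF bij_swap12, of "\<lambda>i. (cmod (ell2_nth x i))\<^sup>2"]
    by (simp add: ell2_norm_sq)
  finally show "norm (fock_H3 x) \<le> norm x * 1"
    by (simp add: power2_le_iff_abs_le)
qed (simp_all add: H3_linear)

definition H_mat :: mat2 where
  "H_mat = (\<chi> i j. if i = j then if i = 1 then 1 else - 1 else 0)"

lemma H_mat_nth [simp]: "H_mat $ 1 $ 1 = 1" "H_mat $ 1 $ 2 = 0" "H_mat $ 2 $ 1 = 0"
  "H_mat $ 2 $ 2 = - 1"
  by (simp_all add: H_mat_def)

text \<open>Modulo the ideal, \<open>z2\<close> sends z1^k to z1^k z2, \<open>B2\<close> sends z1^k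
  z2 to -z1^k, and both kill the other basis monomials. No normalising factor appears because z1^k
  and z1^k z2 have equal weights.\<close>

lemma H3_embed: "fock_H3 (fock_embed \<alpha> p) = fock_embed \<alpha> (drho \<alpha> ((0, 0, H_mat), 0) p)"
proof -
  have coord: "fock_coord (drho \<alpha> ((0, 0, H_mat), 0) p) i =
      (if snd i \<in> {G1, G2} then fock_coord p (swap12 i) else 0)" for i
  proof (transfer, goal_cases)
    case (1 \<alpha> p i)
    have nf: "nf_poly (rho_H3 p) G1 = nf_poly p G2" "nf_poly (rho_H3 p) G2 = nf_poly p G1"
      "nf_poly (rho_H3 p) G3 = 0" "nf_poly (rho_H3 p) G4 = 0"
      by (simp_all add: rho_H3_def B2_def coeff_pCons coeff_pderiv pderiv_pCons two_mult_smult
          coeff_two_mult algebra_simps)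
    have "rho_sp \<alpha> ((0, 0, H_mat), 0) p = rho_H3 p" by simp
    then show ?case
      by (cases i rule: swap12.cases) (simp_all only: nf fst_conv snd_conv swap12.simps, simp_all)
  qed
  have "fock_weight \<alpha> (swap12 i) = fock_weight \<alpha> i" for i
    by (cases i rule: swap12.cases) simp_all
  then show ?thesis
    by (intro ell2_eqI) (simp add: nth_H3 ell2_nth_embed coord)
qed

text \<open>By \<open>fock_H3 ^ 3 = fock_H3\<close> the exponential series sums to
  \<open>exp (t fock_H3) = 1 + (cosh t - 1) fock_H3 ^ 2 + sinh t fock_H3\<close>.\<close>

lemma exp_drho_H3: "\<exists>T. exp_drho \<alpha> (0, 0, H_mat) T"
proof -
  define U where
    "U t x = x + (cosh t - 1) *\<^sub>R fock_H3 (fock_H3 x) + sinh t *\<^sub>R fock_H3 x" for t :: real and x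
  have "clinear (U t)" for t
    by (simp add: clinear_def U_def H3_linear scaleC_add_right scaleC_scaleR scaleR_add_right)
  moreover have "bounded_linear (U t)" for t
    unfolding U_def
    by (intro bounded_linear_add bounded_linear_ident bounded_linear_H3
        bounded_linear_const_scaleR bounded_linear_compose[OF bounded_linear_H3])
  moreover have "U 0 = id"
    by (simp add: U_def fun_eq_iff)
  \<comment> \<open>\<open>H3_cubed\<close> reduces all powers to the first two; comparing
    coefficients leaves the addition formulas of cosh and sinh.\<close>
  moreover have "U (s + t) = U s \<circ> U t" for s t
    by (simp add: U_def fun_eq_iff H3_linear H3_cubed cosh_add sinh_add algebra_simps)
  moreover have "continuous_on UNIV (\<lambda>t. U t x)" for x
    unfolding U_def by (intro continuous_intros)
  moreover have "((\<lambda>t. U t x) has_vector_derivative fock_H3 x) (at 0)" for x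
    unfolding U_def by (auto intro!: derivative_eq_intros)
  ultimately show ?thesis
    unfolding exp_drho_def H3_embed[symmetric] by blast
qed

lemma H3_sl3: "(0, 0, H_mat) \<in> sl3"
  by (simp add: sl3_def trace_def sum_2)

lemma mat_exp_zero: "mat_exp 0 = mat 1"
proof -
  have "(\<lambda>n. (1 / fact n) *\<^sub>R ((\<lambda>Y. (0::mat2) ** Y) ^^ n) (mat 1)) sums
      (\<Sum>n\<in>{0}. (1 / fact n) *\<^sub>R ((\<lambda>Y. (0::mat2) ** Y) ^^ n) (mat 1))"
  proof (rule sums_finite)
    fix n :: nat assume "n \<notin> {0}"
    then show "(1 / fact n) *\<^sub>R ((\<lambda>Y. (0::mat2) ** Y) ^^ n) (mat 1) = 0"
      by (cases n) (simp_all add: matrix_matrix_mult_def vec_eq_iff)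
  qed simp
  then show ?thesis by (simp add: mat_exp_def sums_iff)
qed

lemma mat_exp_H: "mat_exp H_mat = (\<chi> i j. if i = j then if i = 1 then exp 1 else exp (- 1) else 0)"
proof -
  \<comment> \<open>The spectral projections of \<open>H_mat\<close> for the eigenvalues 1 and -1;
    they split the matrix series into two scalar exponential series.\<close>
  define P Q :: mat2 where "P = (\<chi> i j. if i = 1 \<and> j = 1 then 1 else 0)"
    and "Q = (\<chi> i j. if i = 2 \<and> j = 2 then 1 else 0)"
  have pow: "((\<lambda>Y. H_mat ** Y) ^^ n) (mat 1) = P + (- 1) ^ n *\<^sub>R Q" for n
    by (induction n)
      (simp_all add: P_def Q_def mat_def matrix_matrix_mult_def vec_eq_iff forall_2 sum_2)
  have "(\<lambda>n. (1 ^ n /\<^sub>R fact n) *\<^sub>R P + ((- 1) ^ n /\<^sub>R fact n) *\<^sub>R Q) sums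
      (exp 1 *\<^sub>R P + exp (- 1 :: real) *\<^sub>R Q)"
    by (intro sums_add sums_scaleR_left exp_converges)
  then have "mat_exp H_mat = exp 1 *\<^sub>R P + exp (- 1) *\<^sub>R Q"
    by (simp add: mat_exp_def pow sums_iff scaleR_add_right field_simps)
  then show ?thesis by (simp add: P_def Q_def vec_eq_iff forall_2)
qed

text \<open>A group representation is tested on elements of \<open>SL3\<close> only, so the
  exponential of H_3 must be one of them.\<close>

lemma group_exp_H3_SL3: "group_exp (0, 0, H_mat) \<in> SL3"
  by (simp add: SL3_def mat_exp_zero mat_exp_H det_2 mat_def flip: exp_add)

text \<open>Both \<open>ip\<close> and \<open>T\<close> are arbitrary, so that this covers a form
  extended from polynomials, a form given by a symmetry of the completion, and the operators of any
  group action.\<close>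

lemma exp_drho_H3_not_unitary:
  assumes "\<alpha> \<notin> \<nat>" "inner_product ip" "exp_drho \<alpha> (0, 0, H_mat) T"
  shows "\<not> unitary_wrt ip T"
proof
  assume u: "unitary_wrt ip T"
  let ?p = "fock_basis (0, G1) + fock_basis (0, G2)"
  \<comment> \<open>Nonzero weights make \<open>fock_embed\<close> injective: the eigenvector
    equation can be pulled back from the completion, and the image of 1 + z2 is not 0.\<close>
  have w: "fock_weight \<alpha> i \<noteq> 0" for i
    using fock_weight_pos[OF assms(1), of i] by simp
  have fix_coord: "ell2_nth (fock_H3 (fock_embed \<alpha> ?p)) i = ell2_nth (fock_embed \<alpha> ?p) i" for i
    by (cases i rule: swap12.cases) (auto simp: nth_H3 ell2_nth_embed fock_coord_basis)
  have "drho \<alpha> ((0, 0, H_mat), 0) ?p = 1 *\<^sub>R ?p"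
    using fix_coord w by (intro fock_poly_eqI) (simp add: H3_embed ell2_nth_embed)
  then have "T (fock_embed \<alpha> ?p) = exp 1 *\<^sub>R fock_embed \<alpha> ?p"
    by (rule exp_drho_eigenvector[OF assms(3)])
  then have "fock_embed \<alpha> ?p = 0"
    by (rule unitary_wrt_eigenvector[OF assms(2) u]) (simp flip: exp_of_nat_mult)
  then have "ell2_nth (fock_embed \<alpha> ?p) (0, G1) = 0" by simp
  then show False
    using w[of "(0, G1)"] by (simp add: ell2_nth_embed fock_coord_basis)
qed

theorem theorem5p12:
  fixes \<alpha> :: real
  assumes "\<alpha> \<notin> \<nat>"
  shows "\<not> (\<exists>J :: fock_poly \<Rightarrow> fock_poly.
           fundamental_symmetry (bessel_fischer \<alpha>) J \<and> rho0_unitarizable_poly \<alpha> J) \<and>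
         \<not> (\<exists>J :: fock \<Rightarrow> fock. unitarizable (fock_form \<alpha>) (rho0_ops \<alpha>) J) \<and>
         \<not> (\<exists>\<pi>0 d\<pi>. is_rho0 \<alpha> \<pi>0 \<and> extends_drho \<alpha> d\<pi> \<and>
           strong_superunitary_rep \<alpha> fock_grade (fock_form \<alpha>) \<pi>0 d\<pi>)"
proof -
  obtain T where T: "exp_drho \<alpha> (0, 0, H_mat) T"
    using exp_drho_H3 by blast
  then have T_ops: "T \<in> rho0_ops \<alpha>"
    using H3_sl3 by (auto simp: rho0_ops_def)
  note not_unitary = exp_drho_H3_not_unitary[OF assms]
  have 1: "\<not> rho0_unitarizable_poly \<alpha> J" for J
    using not_unitary T T_ops unfolding rho0_unitarizable_poly_def by blast
  have inner: "inner_product (\<lambda>x y. fock_form \<alpha> x (J y))"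
    if "unitarizable (fock_form \<alpha>) \<T> J" for \<T> J
    using that by (simp add: unitarizable_def fundamental_symmetry_def)
  have 2: "\<not> unitarizable (fock_form \<alpha>) (rho0_ops \<alpha>) J" for J
    using not_unitary[OF inner T] T_ops by (auto simp: unitarizable_def)
  have 3: "\<not> unitarizable (fock_form \<alpha>) (\<pi>0 ` SL3) J" if "is_rho0 \<alpha> \<pi>0" for \<pi>0 J
  proof
    assume J: "unitarizable (fock_form \<alpha>) (\<pi>0 ` SL3) J"
    \<comment> \<open>Here the exponential is the operator supplied by \<open>\<pi>0\<close> itself,
      in place of the \<open>T\<close> obtained above.\<close>
    have "exp_drho \<alpha> (0, 0, H_mat) (\<pi>0 (group_exp (0, 0, H_mat)))"
      using that H3_sl3 by (simp only: is_rho0_def)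
    from not_unitary[OF inner[OF J] this] show False
      using J group_exp_H3_SL3 by (auto simp: unitarizable_def simp del: group_exp.simps)
  qed
  show ?thesis
    using 1 2 3 unfolding strong_superunitary_rep_def by blast
qed

end
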